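(* Let $T>0$ be a final time, $0<\Delta t\le T$ a time step, $t^n=n\Delta t$, $N_T=[T/\Delta t]$ (integer part). Let $\mathbf E$, $b$, $\chi$ satisfy the assumptions listed in the context. For each $\varepsilon>0$ let $(\mathbf x^n_\varepsilon,\mathbf v^n_\varepsilon,e^n_{\perp,\varepsilon})_{0\le n\le N_T}$ be given (dropping the index $\varepsilon$) by the semi-implicit scheme $$\text{(S)}\quad\left\{\begin{array}{l} \dfrac{\mathbf x^{n+1}-\mathbf x^n}{\Delta t}=\mathbf v^{n+1},\\[2mm] \dfrac{e_\perp^{n+1}-e_\perp^n}{\Delta t}=\langle\mathbf E_\perp(t^n,\mathbf x^n),\mathbf v_\perp^{n+1}\rangle,\\[2mm] \dfrac{\mathbf v^{n+1}-\mathbf v^n}{\Delta t}=\mathbf H(t^n,\mathbf x^n,\mathbf v_\perp^n,e_\perp^n)-b(t^n,\mathbf x_\perp^n)\dfrac{(\mathbf v_\perp^{n+1})^\perp}{\varepsilon}, \end{array}\right.$$ with initial data $(\mathbf x^0_\varepsilon,\mathbf v^0_\varepsilon,e^0_{\perp,\varepsilon})$, $e^0_{\perp,\varepsilon}\ge0$, uniformly bounded with respect to $\varepsilon>0$. Then: 1. For all $0\le n\le N_T$, $(\mathbf x^n_\varepsilon,\mathbf v^n_\varepsilon,e^n_{\perp,\varepsilon})_{\varepsilon>0}$ is uniformly bounded with respect to $\varepsilon>0$ and $\Delta t>0$. 2. For fixed $\Delta t>0$, the sequence $(\mathbf x^n_\varepsilon,e^n_{\perp,\varepsilon},v^n_{\parallel,\varepsilon})_{1\le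 n\le N_T}$ is a second order consistent approximation with respect to $\varepsilon$ (in the sense given in the context) of the scheme for the drift-kinetic equation $$\text{(L)}\quad\left\{\begin{array}{l} \dfrac{\mathbf x^{n+1}-\mathbf x^n}{\Delta t}=\mathbf U^{\rm gc}(t^n,\mathbf x^n,e_\perp^n,v_\parallel^{n+1}),\\[2mm] \dfrac{e_\perp^{n+1}-e_\perp^n}{\Delta t}=\varepsilon\,e_\perp^n\,\mathrm{div}_{\mathbf x_\perp}\mathbf F_\perp^\perp(t^n,\mathbf x^n),\\[2mm] \dfrac{v_\parallel^{n+1}-v_\parallel^n}{\Delta t}=E_\parallel(t^n,\mathbf x^n). \end{array}\right.$$ 3. The scheme (L) is a first order approximation in $\Delta t$ of the characteristic curves of the drift-kinetic equation, $$\text{(C)}\quad\frac{d\mathbf x}{dt}=\mathbf U^{\rm gc}(t,\mathbf x,e_\perp,v_\parallel),\qquad \frac{de_\perp}{dt}=\varepsilon\,\mathrm{div}_{\mathbf x_\perp}\mathbf F_\perp^\perp(t,\mathbf x)\,e_\perp,\qquad \frac{dv_\parallel}{dt}=E_\parallel(t,\mathbf x).$$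
   Context: Notation. For $\mathbf w=(w_x,w_y,w_z)\in\mathbb R^3$: $w_\parallel=w_z$, $\mathbf w_\perp=(w_x,w_y,0)$, $\mathbf w_\perp^\perp=(-w_y,w_x,0)$; $\mathbf e_z=(0,0,1)$; $\langle\cdot,\cdot\rangle$ is the Euclidean scalar product; $\nabla_{\mathbf x_\perp}=(\partial_x,\partial_y,0)$ and $\mathrm{div}_{\mathbf x_\perp}$ is the divergence in $(x,y)$. Assumptions. The given electric field is $\mathbf E=-\nabla_{\mathbf x}\phi\in W^{1,\infty}((0,T)\times\mathbb R^3)$. The given magnetic intensity $b=b(t,\mathbf x_\perp)$ satisfies $b>b_0>0$ and $b\in W^{2,\infty}((0,T)\times\mathbb R^3)$ (the external magnetic field is $\varepsilon^{-1}b\,\mathbf e_z$). The continuous representatives are used, extended to $t=0$ and $t=T$. The function $\chi\in W^{1,\infty}_{loc}(\mathbb R\times\mathbb R^3)$ satisfies, for all $\mathbf v_\perp=(v_x,v_y,0)$: $\chi(\|\mathbf v_\perp\|^2/2,\mathbf v_\perp)=0$; $\chi(e_\perp,0)=e_\perp$ for all $e_\perp\ge0$; $0\le\chi(e_\perp,\mathbf v_\perp)\le|e_\perp|$ for all $e_\perp\in\mathbb R$. Definitions. $\mathbf H(t,\mathbf x,\mathbf v_\perp,e_\perp)=\mathbf E(t,\mathbf x)-\chi(e_\perp,\mathbf v_\perp)\nabla_{\mathbf x_\perp}\ln b(t,\mathbf x_\perp)$; $\mathbf F(t,\mathbf x)=\mathbf E(t,\mathbf x)/b(t,\mathbf x_\perp)$;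 $$\mathbf U^{\rm gc}(t,\mathbf x,e_\perp,v_\parallel)=v_\parallel\mathbf e_z-\varepsilon\left(\mathbf F_\perp(t,\mathbf x)-\frac{e_\perp}{b^2(t,\mathbf x_\perp)}\nabla_{\mathbf x_\perp}b(t,\mathbf x_\perp)\right)^\perp .$$ Since $\mathbf E$ is a gradient, $\mathrm{div}_{\mathbf x_\perp}\mathbf F_\perp^\perp=-b^{-2}\langle\mathbf E_\perp^\perp,\nabla_{\mathbf x_\perp}b\rangle$ almost everywhere, and this continuous representative is the one used. Item 1 means: there is a constant depending only on $T$, the bound on the initial data, $\mathbf E$, $b$, $\chi$ (not on $\varepsilon$, $\Delta t$, $n$) bounding $\|\mathbf x^n_\varepsilon\|+\|\mathbf v^n_\varepsilon\|+|e^n_{\perp,\varepsilon}|$. "Second order consistent with respect to $\varepsilon$" means: for $n\ge1$, $n+1\le N_T$, the values produced by (S) satisfy each equation of (L) up to an additive residual of norm at most $C(\Delta t)\,\varepsilon^2$, with $C(\Delta t)$ independent of $\varepsilon$ and $n$. "Approximation of order $p$ in $\Delta t$" has its usual meaning for one-step methods: for fixed $\varepsilon$ and sufficiently smooth coefficients, the local truncation error after one step is $O(\Delta t^{p+1})$. *)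

theory Defs
  imports "HOL-Analysis.Analysis"
begin

section \<open>Sobolev spaces with exponent infinity\<close>

text \<open>Distributional derivatives are tested against continuously differentiable functions
  with compact support. By mollification this is the same as testing against smooth ones.\<close>

definition test_function :: "'a::euclidean_space set \<Rightarrow> ('a \<Rightarrow> real) \<Rightarrow> bool" where
  "test_function S \<psi> \<longleftrightarrow>
     (\<forall>z. \<psi> differentiable (at z)) \<and>
     (\<forall>i\<in>Basis. continuous_on UNIV (\<lambda>z. frechet_derivative \<psi> (at z) i)) \<and>
     compact (closure {z. \<psi> z \<noteq> 0}) \<and> closure {z. \<psi> z \<noteq> 0} \<subseteq> S"

definition locally_integrable :: "'a::euclidean_space set \<Rightarrow> ('a \<Rightarrow> real) \<Rightarrow> bool" where
  "locally_integrable S u \<longleftrightarrow> (\<forall>K. compact K \<and> K \<subseteq> S \<longrightarrow> set_integrable lborel K u)"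

definition weak_deriv ::
    "'a::euclidean_space set \<Rightarrow> 'a \<Rightarrow> ('a \<Rightarrow> real) \<Rightarrow> ('a \<Rightarrow> real) \<Rightarrow> bool" where
  "weak_deriv S i u g \<longleftrightarrow>
     locally_integrable S u \<and> locally_integrable S g \<and>
     (\<forall>\<psi>. test_function S \<psi> \<longrightarrow>
        (LINT z:S|lborel. u z * frechet_derivative \<psi> (at z) i) = - (LINT z:S|lborel. g z * \<psi> z))"

definition L_infty :: "'a::euclidean_space set \<Rightarrow> ('a \<Rightarrow> real) \<Rightarrow> bool" where
  "L_infty S f \<longleftrightarrow> set_borel_measurable lborel S f \<and>
     (\<exists>M. AE z in lborel. z \<in> S \<longrightarrow> \<bar>f z\<bar> \<le> M)"

primrec W_infty :: "nat \<Rightarrow> 'a::euclidean_space set \<Rightarrow> ('a \<Rightarrow> real) \<Rightarrow> bool" where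
  "W_infty 0 S f \<longleftrightarrow> L_infty S f"
| "W_infty (Suc k) S f \<longleftrightarrow> L_infty S f \<and>
     (\<forall>i\<in>Basis. \<exists>g. weak_deriv S i f g \<and> W_infty k S g)"

definition W_infty_loc :: "nat \<Rightarrow> 'a::euclidean_space set \<Rightarrow> ('a \<Rightarrow> real) \<Rightarrow> bool" where
  "W_infty_loc k S f \<longleftrightarrow>
     (\<forall>\<Omega>. open \<Omega> \<and> compact (closure \<Omega>) \<and> closure \<Omega> \<subseteq> S \<longrightarrow> W_infty k \<Omega> f)"


section \<open>Vectors and perpendicular differential operators\<close>

definition perp :: "real^3 \<Rightarrow> real^3" where
  "perp w = vector [w$1, w$2, 0]"

definition rot :: "real^3 \<Rightarrow> real^3" where
  "rot w = vector [- w$2, w$1, 0]"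

abbreviation e_z :: "real^3" where
  "e_z \<equiv> vector [0, 0, 1]"

definition grad_perp :: "(real^3 \<Rightarrow> real) \<Rightarrow> real^3 \<Rightarrow> real^3" where
  "grad_perp f x = vector [frechet_derivative f (at x) (axis 1 1),
                           frechet_derivative f (at x) (axis 2 1), 0]"

definition weak_div_perp ::
    "(real \<times> (real^3)) set \<Rightarrow> (real \<times> (real^3) \<Rightarrow> real^3) \<Rightarrow> (real \<times> (real^3) \<Rightarrow> real) \<Rightarrow> bool" where
  "weak_div_perp S V D \<longleftrightarrow>
     locally_integrable S (\<lambda>z. V z $ 1) \<and> locally_integrable S (\<lambda>z. V z $ 2) \<and>
     locally_integrable S D \<and>
     (\<forall>\<psi>. test_function S \<psi> \<longrightarrow>
        (LINT z:S|lborel. V z $ 1 * frechet_derivative \<psi> (at z) (0, axis 1 1)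
                        + V z $ 2 * frechet_derivative \<psi> (at z) (0, axis 2 1))
        = - (LINT z:S|lborel. D z * \<psi> z))"


section \<open>Fields and schemes\<close>

text \<open>The magnetic intensity \<open>b\<close> is only ever evaluated at points \<open>(t, perp x)\<close>.
  The gradients below are classical: for a continuous \<open>b\<close> in \<open>W_infty 2\<close> the function
  \<open>\<lambda>x. b (t, perp x)\<close> is continuously differentiable for every \<open>t\<close>, the end points of the
  time interval included.\<close>

definition H_field ::
    "(real \<times> (real^3) \<Rightarrow> real^3) \<Rightarrow> (real \<times> (real^3) \<Rightarrow> real) \<Rightarrow> (real \<times> (real^3) \<Rightarrow> real) \<Rightarrow>
     real \<Rightarrow> real^3 \<Rightarrow> real^3 \<Rightarrow> real \<Rightarrow> real^3" where
  "H_field E b chi t x v e = E (t, x) - chi (e, v) *\<^sub>R grad_perp (\<lambda>y. ln (b (t, perp y))) x"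

definition F_field ::
    "(real \<times> (real^3) \<Rightarrow> real^3) \<Rightarrow> (real \<times> (real^3) \<Rightarrow> real) \<Rightarrow> real \<Rightarrow> real^3 \<Rightarrow> real^3" where
  "F_field E b t x = (1 / b (t, perp x)) *\<^sub>R E (t, x)"

definition U_gc ::
    "real \<Rightarrow> (real \<times> (real^3) \<Rightarrow> real^3) \<Rightarrow> (real \<times> (real^3) \<Rightarrow> real) \<Rightarrow>
     real \<Rightarrow> real^3 \<Rightarrow> real \<Rightarrow> real \<Rightarrow> real^3" where
  "U_gc \<epsilon> E b t x e v\<^sub>p = v\<^sub>p *\<^sub>R e_z
     - \<epsilon> *\<^sub>R rot (perp (F_field E b t x)
                - (e / (b (t, perp x))\<^sup>2) *\<^sub>R grad_perp (\<lambda>y. b (t, perp y)) x)"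

definition num_steps :: "real \<Rightarrow> real \<Rightarrow> nat" where
  "num_steps T dt = nat \<lfloor>T / dt\<rfloor>"

definition semi_implicit_scheme ::
    "(real \<times> (real^3) \<Rightarrow> real^3) \<Rightarrow> (real \<times> (real^3) \<Rightarrow> real) \<Rightarrow> (real \<times> (real^3) \<Rightarrow> real) \<Rightarrow>
     real \<Rightarrow> real \<Rightarrow> real \<Rightarrow> (nat \<Rightarrow> real^3) \<Rightarrow> (nat \<Rightarrow> real^3) \<Rightarrow> (nat \<Rightarrow> real) \<Rightarrow> bool" where
  "semi_implicit_scheme E b chi T \<epsilon> dt x v e \<longleftrightarrow>
     (\<forall>n. n + 1 \<le> num_steps T dt \<longrightarrow> (let t = real n * dt in
        (1 / dt) *\<^sub>R (x (n + 1) - x n) = v (n + 1) \<and>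
        (e (n + 1) - e n) / dt = inner (perp (E (t, x n))) (perp (v (n + 1))) \<and>
        (1 / dt) *\<^sub>R (v (n + 1) - v n)
          = H_field E b chi t (x n) (perp (v n)) (e n)
            - b (t, perp (x n)) *\<^sub>R ((1 / \<epsilon>) *\<^sub>R rot (perp (v (n + 1))))))"

text \<open>States of the drift-kinetic system are triples of the position, the perpendicular
  energy and the parallel velocity. The argument \<open>D\<close> stands for the divergence
  of the field \<open>rot (perp F)\<close> with respect to the perpendicular variables.\<close>

definition gc_residual ::
    "real \<Rightarrow> (real \<times> (real^3) \<Rightarrow> real^3) \<Rightarrow> (real \<times> (real^3) \<Rightarrow> real) \<Rightarrow> (real \<times> (real^3) \<Rightarrow> real) \<Rightarrow>
     real \<Rightarrow> real \<Rightarrow> (real^3) \<times> real \<times> real \<Rightarrow> (real^3) \<times> real \<times> real \<Rightarrow> (real^3) \<times> real \<times> real" where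
  "gc_residual \<epsilon> E b D dt t = (\<lambda>(x, e, v\<^sub>p) (x', e', v\<^sub>p').
     ((1 / dt) *\<^sub>R (x' - x) - U_gc \<epsilon> E b t x e v\<^sub>p',
      (e' - e) / dt - \<epsilon> * e * D (t, x),
      (v\<^sub>p' - v\<^sub>p) / dt - E (t, x) $ 3))"

definition gc_step ::
    "real \<Rightarrow> (real \<times> (real^3) \<Rightarrow> real^3) \<Rightarrow> (real \<times> (real^3) \<Rightarrow> real) \<Rightarrow> (real \<times> (real^3) \<Rightarrow> real) \<Rightarrow>
     real \<Rightarrow> real \<Rightarrow> (real^3) \<times> real \<times> real \<Rightarrow> (real^3) \<times> real \<times> real \<Rightarrow> bool" where
  "gc_step \<epsilon> E b D dt t y y' \<longleftrightarrow> gc_residual \<epsilon> E b D dt t y y' = 0"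

definition gc_vector_field ::
    "real \<Rightarrow> (real \<times> (real^3) \<Rightarrow> real^3) \<Rightarrow> (real \<times> (real^3) \<Rightarrow> real) \<Rightarrow> (real \<times> (real^3) \<Rightarrow> real) \<Rightarrow>
     real \<Rightarrow> (real^3) \<times> real \<times> real \<Rightarrow> (real^3) \<times> real \<times> real" where
  "gc_vector_field \<epsilon> E b D t = (\<lambda>(x, e, v\<^sub>p).
     (U_gc \<epsilon> E b t x e v\<^sub>p, \<epsilon> * D (t, x) * e, E (t, x) $ 3))"

text \<open>\<open>step h t y y'\<close> says that the one-step method maps \<open>y\<close> at time \<open>t\<close> to \<open>y'\<close>
  at time \<open>t + h\<close>. The bound on the local truncation error is locally uniform in
  the starting point.\<close>

definition approximation_of_order ::
    "nat \<Rightarrow> real \<Rightarrow> (real \<Rightarrow> 'a::real_normed_vector \<Rightarrow> 'a) \<Rightarrow>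
     (real \<Rightarrow> real \<Rightarrow> 'a \<Rightarrow> 'a \<Rightarrow> bool) \<Rightarrow> bool" where
  "approximation_of_order p T f step \<longleftrightarrow>
     (\<forall>R. \<exists>C. \<forall>h t y y1.
        0 < h \<and> 0 \<le> t \<and> t + h \<le> T \<and> norm (y t) \<le> R \<and>
        (\<forall>s\<in>{t..t + h}. (y has_vector_derivative f s (y s)) (at s within {t..t + h})) \<and>
        step h t (y t) y1
        \<longrightarrow> norm (y (t + h) - y1) \<le> C * h ^ (p + 1))"

end

theory Submission
  imports Defs
begin

text \<open>The schemes can be analysed by elementary estimates once the fields are classical
  functions: \<open>E\<close> and \<open>b\<close> are bounded and Lipschitz, the perpendicular gradient of \<open>b\<close> exists
  everywhere and is Lipschitz, \<open>chi\<close> is locally Lipschitz, and the divergence of \<open>rot (perp F)\<close> is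
  \<open>(E\<^sub>2 \<partial>\<^sub>1 b - E\<^sub>1 \<partial>\<^sub>2 b) / b\<^sup>2\<close>, all of this up to the end points of the time interval. The hypotheses
  speak of bounded weak derivatives, and mollification bridges the gap. Convolution with a
  nonnegative kernel of mass one turns weak derivatives into classical ones without increasing
  their bounds, so Lipschitz estimates hold uniformly in the radius and survive the limit
  (\<open>W_infty_imp_lipschitz\<close>). One order higher, a compactness argument for the mollified gradients
  yields a Taylor estimate with quadratic remainder and a Lipschitz gradient
  (\<open>W_infty_2_imp_C11\<close>). The divergence formula results from testing against \<open>b\<close> times
  the kernel: this removes the quotient \<open>E / b\<close>, and the derivatives of \<open>E\<close> that remain form a curl,
  which vanishes for a gradient (\<open>divergence_rot_over_b\<close>).

  Uniform bounds. The magnetic force is orthogonal to the new velocity and is treated implicitly,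
  so it cannot increase the speed, however small \<open>\<epsilon>\<close> is. The other terms grow at most
  linearly, and a discrete Gronwall argument finishes the proof (\<open>uniform_bound\<close>).

  Consistency in \<open>\<epsilon>\<close>. All terms of the velocity equation are bounded except the magnetic one, which
  carries the factor \<open>1 / \<epsilon>\<close>; hence the perpendicular velocity is \<open>O(\<epsilon>)\<close> from the first step on.
  Solving the equation for it produces the drift velocity plus \<open>\<epsilon>\<close> times the difference quotient
  of perpendicular velocities and \<open>\<epsilon>\<close> times a multiple of \<open>e - chi (e, v)\<close>. The former is \<open>O(\<epsilon>\<^sup>2)\<close>
  from the second velocity on. So is the latter, because \<open>chi (e, 0) = e\<close> for \<open>e \<ge> 0\<close> and the energy,
  nonnegative at the start, stays above \<open>- C * \<epsilon>\<close>. By the divergence formula the residual of the energy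
  equation is the work of \<open>E\<close> along the residual of the position equation; the parallel velocity
  satisfies its equation exactly (\<open>second_order_consistent\<close>).

  Accuracy in time. The limit scheme is the explicit Euler method up to a term \<open>h\<^sup>2\<close> times the parallel
  electric field, and the vector field is Lipschitz on the bounded set in which solutions
  remain (\<open>first_order_in_time\<close>).\<close>

section \<open>A twice differentiable mollifier\<close>

text \<open>The cube of this function is a radial bump. The third power is the smallest integer power
  that is twice continuously differentiable across the sphere of radius \<open>\<delta>\<close>. Two derivatives
  are needed: a partial derivative of the kernel will itself serve as a test function.\<close>

definition bump :: "real \<Rightarrow> 'a::euclidean_space \<Rightarrow> real" where
  "bump \<delta> z = max 0 (\<delta>\<^sup>2 - z \<bullet> z)"

lemma bump_nonneg: "0 \<le> bump \<delta> z"
  by (simp add: bump_def)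

lemma bump_le: "bump \<delta> z \<le> \<delta>\<^sup>2"
  by (simp add: bump_def)

lemma bump_eq_0: "\<delta> \<ge> 0 \<Longrightarrow> \<delta> \<le> norm z \<Longrightarrow> bump \<delta> z = 0"
  by (simp add: bump_def dot_square_norm power_mono)

lemma continuous_bump [continuous_intros]:
  "continuous_on A f \<Longrightarrow> continuous_on A (\<lambda>z. bump \<delta> (f z))"
  unfolding bump_def by (intro continuous_intros)

lemma DERIV_positive_part_power:
  "((\<lambda>r::real. max 0 r ^ Suc (Suc n)) has_real_derivative real (n + 2) * max 0 r ^ Suc n) (at r)"
proof -
  consider "r > 0" | "r < 0" | "r = 0" by linarith
  then show ?thesis
  proof cases
    case 1
    have "((\<lambda>r::real. r ^ Suc (Suc n)) has_real_derivative real (n + 2) * max 0 r ^ Suc n) (at r)"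
      using 1 by (intro DERIV_cong[OF DERIV_pow]) simp
    then show ?thesis
      by (rule has_field_derivative_transform_within_open[of _ _ _ "{0<..}"]) (use 1 in auto)
  next
    case 2
    have "((\<lambda>r::real. 0) has_real_derivative real (n + 2) * max 0 r ^ Suc n) (at r)"
      using 2 by simp
    then show ?thesis
      by (rule has_field_derivative_transform_within_open[of _ _ _ "{..<0}"]) (use 2 in auto)
  next
    case 3
    have "((\<lambda>h::real. max 0 h ^ Suc (Suc n) / h) \<longlongrightarrow> 0) (at 0)"
    proof (rule Lim_null_comparison)
      show "\<forall>\<^sub>F h::real in at 0. norm (max 0 h ^ Suc (Suc n) / h) \<le> \<bar>h\<bar> ^ Suc n"
        by (auto simp: max_def mult_nonpos_nonneg intro!: always_eventually)
      show "((\<lambda>h::real. \<bar>h\<bar> ^ Suc n) \<longlongrightarrow> 0) (at 0)"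
        by (rule tendsto_eq_intros | simp)+
    qed
    then show ?thesis
      using 3 by (simp add: DERIV_def)
  qed
qed

lemma has_derivative_bump_power:
  "((\<lambda>z::'a::euclidean_space. bump \<delta> z ^ Suc (Suc n)) has_derivative
      (\<lambda>k. - (2 * real (n + 2) * bump \<delta> z ^ Suc n) * (z \<bullet> k))) (at z within A)"
proof -
  have 1: "((\<lambda>z::'a. \<delta>\<^sup>2 - z \<bullet> z) has_derivative (\<lambda>k. - (2 * (z \<bullet> k)))) (at z within A)"
    by (auto intro!: derivative_eq_intros simp: inner_commute)
  have "((\<lambda>z::'a. max 0 (\<delta>\<^sup>2 - z \<bullet> z) ^ Suc (Suc n)) has_derivative
      (\<lambda>k. (- (2 * (z \<bullet> k))) * (real (n + 2) * max 0 (\<delta>\<^sup>2 - z \<bullet> z) ^ Suc n))) (at z within A)"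
    by (rule DERIV_compose_FDERIV[OF DERIV_positive_part_power 1])
  then show ?thesis
    unfolding bump_def by (simp add: algebra_simps)
qed

text \<open>Only the positivity of the mass matters, so its value is never computed. The type argument
  fixes the space over which the bump is integrated.\<close>

definition bump_mass :: "'a::euclidean_space itself \<Rightarrow> real \<Rightarrow> real" where
  "bump_mass _ \<delta> = (LINT z::'a|lborel. bump \<delta> z ^ 3)"

definition mollifier :: "real \<Rightarrow> 'a::euclidean_space \<Rightarrow> real" where
  "mollifier \<delta> z = bump \<delta> z ^ 3 / bump_mass TYPE('a) \<delta>"

definition mollifier_grad :: "real \<Rightarrow> 'a::euclidean_space \<Rightarrow> 'a" where
  "mollifier_grad \<delta> z = (- 6 * (bump \<delta> z)\<^sup>2 / bump_mass TYPE('a) \<delta>) *\<^sub>R z"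

lemma integrable_compact_support:
  fixes f :: "'a::euclidean_space \<Rightarrow> real"
  assumes "continuous_on UNIV f" "\<And>z. r \<le> dist x z \<Longrightarrow> f z = 0"
  shows "integrable lborel f"
proof -
  have "integrable lborel (\<lambda>z. indicator (cball x r) z *\<^sub>R f z)"
    by (rule borel_integrable_compact) (auto intro: continuous_on_subset[OF assms(1)])
  moreover have "(\<lambda>z. indicator (cball x r) z *\<^sub>R f z) = f"
    using assms(2) by (force simp: indicator_def fun_eq_iff)
  ultimately show ?thesis by simp
qed

lemma bump_mass_pos:
  assumes "\<delta> > 0"
  shows "bump_mass TYPE('a::euclidean_space) \<delta> > 0"
proof -
  let ?B = "cball (0::'a) (\<delta>/2)"
  have "0 < (\<delta>\<^sup>2 / 2)^3 * measure lborel ?B"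
    using assms content_cball_pos[of "\<delta>/2" "0::'a"] by simp
  also have "\<dots> = (LINT z|lborel. (\<delta>\<^sup>2 / 2)^3 * indicator ?B z)"
    by (subst integral_mult_right_zero) auto
  also have "\<dots> \<le> (LINT z::'a|lborel. bump \<delta> z ^ 3)"
  proof (rule integral_mono)
    show "integrable lborel (\<lambda>z. (\<delta>\<^sup>2 / 2)^3 * indicator ?B z :: real)"
      by (intro integrable_mult_right integrable_real_indicator)
        (use emeasure_lborel_cball_finite[of "0::'a" "\<delta>/2"] in \<open>auto simp: infinity_ennreal_def\<close>)
    show "integrable lborel (\<lambda>z::'a. bump \<delta> z ^ 3)"
      by (rule integrable_compact_support[of _ \<delta> 0])
        (use assms in \<open>auto intro!: continuous_intros simp: bump_eq_0\<close>)
    fix z :: 'a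
    show "(\<delta>\<^sup>2 / 2)^3 * indicator ?B z \<le> bump \<delta> z ^ 3"
    proof (cases "z \<in> ?B")
      case True
      then have "z \<bullet> z \<le> (\<delta>/2)\<^sup>2" by (simp add: dot_square_norm power_mono)
      then have "z \<bullet> z \<le> \<delta>\<^sup>2 / 4" by (simp add: power_divide)
      then have "\<delta>\<^sup>2 / 2 \<le> \<delta>\<^sup>2 - z \<bullet> z"
        using inner_ge_zero[of z] by linarith
      then have "\<delta>\<^sup>2 / 2 \<le> bump \<delta> z"
        unfolding bump_def by linarith
      then show ?thesis using True by (simp add: power_mono)
    qed (simp add: bump_nonneg)
  qed
  finally show ?thesis by (simp add: bump_mass_def)
qed

lemma mollifier_nonneg: "\<delta> > 0 \<Longrightarrow> 0 \<le> mollifier \<delta> (z::'a::euclidean_space)"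
  using bump_mass_pos[of \<delta>, where 'a = 'a] by (simp add: mollifier_def bump_nonneg)

lemma mollifier_eq_0: "\<delta> > 0 \<Longrightarrow> \<delta> \<le> norm z \<Longrightarrow> mollifier \<delta> z = 0"
  by (simp add: mollifier_def bump_eq_0)

lemma mollifier_grad_eq_0: "\<delta> > 0 \<Longrightarrow> \<delta> \<le> norm z \<Longrightarrow> mollifier_grad \<delta> z = 0"
  by (simp add: mollifier_grad_def bump_eq_0)

lemma continuous_mollifier [continuous_intros]:
  "continuous_on A f \<Longrightarrow> continuous_on A (\<lambda>z. mollifier \<delta> (f z))"
  unfolding mollifier_def divide_inverse by (intro continuous_intros)

lemma continuous_mollifier_grad [continuous_intros]:
  "continuous_on A f \<Longrightarrow> continuous_on A (\<lambda>z. mollifier_grad \<delta> (f z))"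
  unfolding mollifier_grad_def divide_inverse by (intro continuous_intros)

lemma has_derivative_mollifier:
  "(mollifier \<delta> has_derivative (\<lambda>k. mollifier_grad \<delta> z \<bullet> k)) (at (z::'a::euclidean_space) within A)"
proof -
  have "((\<lambda>z::'a. bump \<delta> z ^ 3 / bump_mass TYPE('a) \<delta>) has_derivative
      (\<lambda>k. (- (6 * (bump \<delta> z)\<^sup>2) * (z \<bullet> k)) / bump_mass TYPE('a) \<delta>)) (at z within A)"
    unfolding divide_inverse
    using has_derivative_bump_power[of \<delta> 1 z A]
    by (intro has_derivative_mult_left) (simp add: numeral_eq_Suc)
  then show ?thesis
    unfolding mollifier_def[abs_def] mollifier_grad_def by simp
qed

definition mollifier_hess :: "real \<Rightarrow> 'a::euclidean_space \<Rightarrow> 'a \<Rightarrow> 'a" where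
  "mollifier_hess \<delta> z k = (6 / bump_mass TYPE('a) \<delta>) *\<^sub>R
      ((4 * bump \<delta> z * (z \<bullet> k)) *\<^sub>R z - (bump \<delta> z)\<^sup>2 *\<^sub>R k)"

lemma continuous_mollifier_hess [continuous_intros]:
  "continuous_on A f \<Longrightarrow> continuous_on A (\<lambda>z. mollifier_hess \<delta> (f z) k)"
  unfolding mollifier_hess_def by (intro continuous_intros)

lemma has_derivative_mollifier_grad:
  "(mollifier_grad \<delta> has_derivative mollifier_hess \<delta> z) (at (z::'a::euclidean_space) within A)"
proof -
  have "((\<lambda>z::'a. (- 6 / bump_mass TYPE('a) \<delta>) *\<^sub>R ((bump \<delta> z)\<^sup>2 *\<^sub>R z)) has_derivative
      (\<lambda>k. (- 6 / bump_mass TYPE('a) \<delta>) *\<^sub>R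
          ((bump \<delta> z)\<^sup>2 *\<^sub>R k + (- (4 * bump \<delta> z) * (z \<bullet> k)) *\<^sub>R z))) (at z within A)"
    using has_derivative_bump_power[of \<delta> 0 z A]
    by (intro has_derivative_scaleR_right has_derivative_scaleR has_derivative_ident)
       (simp add: numeral_eq_Suc)
  moreover have "(\<lambda>k. (- 6 / bump_mass TYPE('a) \<delta>) *\<^sub>R
          ((bump \<delta> z)\<^sup>2 *\<^sub>R k + (- (4 * bump \<delta> z) * (z \<bullet> k)) *\<^sub>R z)) = mollifier_hess \<delta> z"
    by (auto simp: mollifier_hess_def fun_eq_iff scaleR_diff_right scaleR_add_right)
  moreover have "(\<lambda>z::'a. (- 6 / bump_mass TYPE('a) \<delta>) *\<^sub>R ((bump \<delta> z)\<^sup>2 *\<^sub>R z)) = mollifier_grad \<delta>"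
    by (auto simp: mollifier_grad_def fun_eq_iff)
  ultimately show ?thesis by simp
qed

lemma mollifier_hess_symmetric:
  "mollifier_hess \<delta> z k \<bullet> l = mollifier_hess \<delta> z l \<bullet> k"
  by (simp add: mollifier_hess_def inner_diff_left inner_commute[of k l] mult_ac)

lemma mollifier_hess_bound:
  fixes z k :: "'a::euclidean_space"
  assumes "\<delta> > 0"
  shows "norm (mollifier_hess \<delta> z k) \<le> 30 * \<delta>^4 / bump_mass TYPE('a) \<delta> * norm k"
proof -
  have q: "bump \<delta> z * (norm z)\<^sup>2 \<le> \<delta>^4"
  proof (cases "norm z \<le> \<delta>")
    case True
    then have "bump \<delta> z * (norm z)\<^sup>2 \<le> \<delta>\<^sup>2 * \<delta>\<^sup>2"
      by (intro mult_mono bump_le power_mono) auto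
    then show ?thesis by (simp add: power2_eq_square power4_eq_xxxx mult_ac)
  qed (use assms in \<open>simp add: bump_eq_0\<close>)
  have "norm ((4 * bump \<delta> z * (z \<bullet> k)) *\<^sub>R z - (bump \<delta> z)\<^sup>2 *\<^sub>R k)
      \<le> 4 * bump \<delta> z * \<bar>z \<bullet> k\<bar> * norm z + (bump \<delta> z)\<^sup>2 * norm k"
    by (rule order_trans[OF norm_triangle_ineq4]) (simp add: bump_nonneg abs_mult)
  also have "\<dots> \<le> 4 * bump \<delta> z * (norm z * norm k) * norm z + (\<delta>\<^sup>2)\<^sup>2 * norm k"
    by (intro add_mono mult_right_mono mult_left_mono power_mono bump_le)
       (auto simp: bump_nonneg Cauchy_Schwarz_ineq2)
  also have "\<dots> = (4 * (bump \<delta> z * (norm z)\<^sup>2) + \<delta>^4) * norm k"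
    by (simp add: power2_eq_square power4_eq_xxxx algebra_simps)
  also have "\<dots> \<le> (5 * \<delta>^4) * norm k"
    using q by (intro mult_right_mono) auto
  finally have "6 / bump_mass TYPE('a) \<delta> * norm ((4 * bump \<delta> z * (z \<bullet> k)) *\<^sub>R z - (bump \<delta> z)\<^sup>2 *\<^sub>R k)
      \<le> 6 / bump_mass TYPE('a) \<delta> * (5 * \<delta>^4 * norm k)"
    using bump_mass_pos[OF assms, where 'a = 'a] by (intro mult_left_mono) auto
  then show ?thesis
    using bump_mass_pos[OF assms, where 'a = 'a]
    by (simp add: mollifier_hess_def)
qed

text \<open>The Hessian is bounded, so the remainder of the first-order expansion is quadratic uniformly
  in the base point. This uniformity is what lets one differentiate a convolution with a merely
  integrable function.\<close>

lemma mollifier_taylor: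
  assumes "\<delta> > 0"
  obtains L where "\<And>w h. \<bar>mollifier \<delta> (w + h) - mollifier \<delta> w - mollifier_grad \<delta> w \<bullet> h\<bar> \<le> L * (norm (h::'a::euclidean_space))\<^sup>2"
proof
  define L where "L = 30 * \<delta>^4 / bump_mass TYPE('a) \<delta>"
  have L: "L \<ge> 0" using bump_mass_pos[OF assms, where 'a = 'a] by (simp add: L_def)
  have lip: "norm (mollifier_grad \<delta> x - mollifier_grad \<delta> y) \<le> L * norm (x - y)" for x y :: 'a
  proof (rule differentiable_bound[of UNIV])
    show "onorm (mollifier_hess \<delta> x) \<le> L" for x :: 'a
      using mollifier_hess_bound[OF assms] by (intro onorm_le) (auto simp: L_def)
  qed (auto intro: has_derivative_mollifier_grad)
  fix w h :: 'a
  have "norm (mollifier \<delta> (w + h) - mollifier \<delta> w - mollifier_grad \<delta> w \<bullet> (w + h - w))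
      \<le> norm (w + h - w) * (L * norm h)"
  proof (rule differentiable_bound_linearization[where S = "cball w (norm h)" and f' = "\<lambda>x k. mollifier_grad \<delta> x \<bullet> k"])
    show "w + t *\<^sub>R (w + h - w) \<in> cball w (norm h)" if "t \<in> {0..1}" for t
      using that by (auto simp: dist_norm mult_left_le_one_le)
    show "onorm ((\<lambda>k. mollifier_grad \<delta> x \<bullet> k) - (\<lambda>k. mollifier_grad \<delta> w \<bullet> k)) \<le> L * norm h"
      if "x \<in> cball w (norm h)" for x
    proof (rule onorm_le)
      fix k
      have "norm (mollifier_grad \<delta> x - mollifier_grad \<delta> w) \<le> L * norm h"
        by (rule order_trans[OF lip mult_left_mono]) (use that L in \<open>auto simp: dist_norm norm_minus_commute\<close>)
      then show "norm (((\<lambda>k. mollifier_grad \<delta> x \<bullet> k) - (\<lambda>k. mollifier_grad \<delta> w \<bullet> k)) k) \<le> L * norm h * norm k"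
        using Cauchy_Schwarz_ineq2[of "mollifier_grad \<delta> x - mollifier_grad \<delta> w" k]
          mult_right_mono[OF _ norm_ge_zero[of k]] order_trans
        unfolding fun_diff_def real_norm_def inner_diff_left[symmetric] by blast
    qed
  qed (auto intro!: has_derivative_mollifier)
  then show "\<bar>mollifier \<delta> (w + h) - mollifier \<delta> w - mollifier_grad \<delta> w \<bullet> h\<bar> \<le> L * (norm h)\<^sup>2"
    by (simp add: power2_eq_square mult_ac)
qed

text \<open>Reflection and translation preserve Lebesgue measure, so the kernel has the same integral
  wherever it is centred.\<close>

lemma mollifier_integral:
  fixes x :: "'a::euclidean_space"
  assumes "\<delta> > 0"
  shows "integrable lborel (\<lambda>z. mollifier \<delta> (x - z))" "(LINT z|lborel. mollifier \<delta> (x - z)) = 1"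
proof -
  show "integrable lborel (\<lambda>z. mollifier \<delta> (x - z))"
    by (rule integrable_compact_support[of _ \<delta> x])
       (use assms in \<open>auto intro!: continuous_intros mollifier_eq_0 simp: dist_norm\<close>)
  have meas: "(\<lambda>z::'a. mollifier \<delta> z) \<in> borel_measurable borel"
    by (intro borel_measurable_continuous_onI continuous_intros)
  have "(lborel :: 'a measure) = distr lborel borel (\<lambda>z. x - z)"
    using lborel_affine[of "-1" x] by (simp add: density_1)
  then have "(LINT z::'a|lborel. mollifier \<delta> z) = (LINT z|distr lborel borel (\<lambda>z. x - z). mollifier \<delta> z)"
    by simp
  also have "\<dots> = (LINT z|lborel. mollifier \<delta> (x - z))"
    using meas by (intro integral_distr) auto
  finally have "(LINT z|lborel. mollifier \<delta> (x - z)) = (LINT z::'a|lborel. mollifier \<delta> z)" by simp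
  also have "\<dots> = 1"
    using bump_mass_pos[OF assms, where 'a = 'a]
    by (simp add: mollifier_def bump_mass_def)
  finally show "(LINT z|lborel. mollifier \<delta> (x - z)) = 1" .
qed

section \<open>Mollification and weak derivatives\<close>

text \<open>The integral runs over \<open>S\<close> because nothing is known about \<open>u\<close> elsewhere. At points whose
  \<open>\<delta>\<close>-ball lies inside \<open>S\<close> this is the usual convolution.\<close>

definition mollify :: "'a::euclidean_space set \<Rightarrow> real \<Rightarrow> ('a \<Rightarrow> real) \<Rightarrow> 'a \<Rightarrow> real" where
  "mollify S \<delta> u x = (LINT z:S|lborel. u z * mollifier \<delta> (x - z))"

lemma set_integrable_mult_continuous:
  fixes u p :: "'a::euclidean_space \<Rightarrow> real"
  assumes "set_integrable lborel K u" "compact K" "continuous_on UNIV p"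
  shows "set_integrable lborel K (\<lambda>z. u z * p z)"
proof -
  have "bounded (p ` K)"
    using assms(2,3) by (intro compact_imp_bounded compact_continuous_image continuous_on_subset[OF assms(3)]) auto
  then obtain M where M: "\<And>z. z \<in> K \<Longrightarrow> \<bar>p z\<bar> \<le> M"
    by (auto simp: bounded_iff)
  have [measurable]: "p \<in> borel_measurable borel"
    by (intro borel_measurable_continuous_onI assms)
  have "integrable lborel (\<lambda>z. M * (indicator K z *\<^sub>R u z))"
    using assms(1) unfolding set_integrable_def by (intro integrable_mult_right)
  moreover have "(\<lambda>z. (indicator K z *\<^sub>R u z) * p z) \<in> borel_measurable lborel"
    using assms(1) unfolding set_integrable_def by (intro borel_measurable_times) auto
  ultimately have "integrable lborel (\<lambda>z. (indicator K z *\<^sub>R u z) * p z)"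
    by (rule Bochner_Integration.integrable_bound)
       (use M in \<open>auto simp: indicator_def abs_mult mult.commute intro!: AE_I2 mult_right_mono order_trans[OF M abs_ge_self]\<close>)
  then show ?thesis unfolding set_integrable_def by (simp add: mult.assoc)
qed

lemma set_integral_support:
  fixes f :: "'a::euclidean_space \<Rightarrow> real"
  assumes "K \<subseteq> S" "\<And>z. z \<notin> K \<Longrightarrow> f z = 0"
  shows "(LINT z:S|lborel. f z) = (LINT z:K|lborel. f z)"
  unfolding set_lebesgue_integral_def
  by (rule Bochner_Integration.integral_cong) (use assms in \<open>auto simp: indicator_def\<close>)

text \<open>A mollification is an average with a probability density supported in the ball of
  radius \<open>\<delta>\<close>, so it inherits every bound on the distance to a constant. The case \<open>c = 0\<close>
  says that sup norms do not increase, the case \<open>c = u x\<close> gives convergence at points of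
  continuity.\<close>

lemma mollify_near:
  assumes "cball x \<delta> \<subseteq> S" "\<delta> > 0" "set_integrable lborel (cball x \<delta>) g"
    and "AE z in lborel. z \<in> cball x \<delta> \<longrightarrow> \<bar>g z - c\<bar> \<le> M"
  shows "\<bar>mollify S \<delta> g x - c\<bar> \<le> M"
proof -
  let ?K = "cball x \<delta>" and ?k = "\<lambda>z. mollifier \<delta> (x - z)"
  have k: "continuous_on UNIV ?k" by (intro continuous_intros)
  have out: "z \<notin> ?K \<Longrightarrow> ?k z = 0" for z
    using assms(2) by (intro mollifier_eq_0) (auto simp: dist_norm)
  have int: "set_integrable lborel ?K (\<lambda>z. g z * ?k z)"
    using assms k by (intro set_integrable_mult_continuous) auto
  have kint: "integrable lborel ?k" "(LINT z|lborel. ?k z) = 1"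
    using mollifier_integral[OF assms(2), of x] by auto
  have "mollify S \<delta> g x = (LINT z:?K|lborel. g z * ?k z)"
    unfolding mollify_def using out assms(1) by (intro set_integral_support) auto
  moreover have "c = (LINT z|lborel. c * ?k z)"
    using kint by simp
  ultimately have "mollify S \<delta> g x - c = (LINT z|lborel. indicator ?K z *\<^sub>R (g z * ?k z) - c * ?k z)"
    using int kint unfolding set_lebesgue_integral_def set_integrable_def
    by (subst Bochner_Integration.integral_diff) auto
  also have "\<bar>\<dots>\<bar> \<le> (LINT z|lborel. M * ?k z)"
  proof (rule order_trans[OF integral_abs_bound integral_mono_AE])
    show "integrable lborel (\<lambda>z. \<bar>indicator ?K z *\<^sub>R (g z * ?k z) - c * ?k z\<bar>)"
      using int kint unfolding set_integrable_def
      by (intro integrable_abs Bochner_Integration.integrable_diff integrable_mult_right) auto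
    show "integrable lborel (\<lambda>z. M * ?k z)" using kint by auto
    show "AE z in lborel. \<bar>indicator ?K z *\<^sub>R (g z * ?k z) - c * ?k z\<bar> \<le> M * ?k z"
      using assms(4)
    proof eventually_elim
      case (elim z)
      show ?case
      proof (cases "z \<in> ?K")
        case True
        then show ?thesis
          using elim mollifier_nonneg[OF assms(2), of "x - z"]
          by (simp add: left_diff_distrib[symmetric] abs_mult mult_right_mono del: mem_cball)
      qed (simp add: out)
    qed
  qed
  also have "\<dots> = M" using kint by simp
  finally show ?thesis .
qed
lemma abs_mollify_le:
  assumes "cball x \<delta> \<subseteq> S" "\<delta> > 0" "set_integrable lborel (cball x \<delta>) g"
    and "AE z in lborel. z \<in> S \<longrightarrow> \<bar>g z\<bar> \<le> M"
  shows "\<bar>mollify S \<delta> g x\<bar> \<le> M"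
proof -
  have "AE z in lborel. z \<in> cball x \<delta> \<longrightarrow> \<bar>g z - 0\<bar> \<le> M"
    using assms(4) by eventually_elim (use assms(1) in auto)
  from mollify_near[OF assms(1-3) this] show ?thesis by simp
qed

lemma tendsto_mollify:
  assumes "open S" "continuous_on S u" "x \<in> S"
  shows "((\<lambda>\<delta>. mollify S \<delta> u x) \<longlongrightarrow> u x) (at_right 0)"
proof (rule tendstoI)
  fix e :: real assume e: "e > 0"
  obtain r where r: "r > 0" "cball x r \<subseteq> S" using assms open_contains_cball by blast
  have "isCont u x" using assms continuous_on_eq_continuous_at by blast
  then obtain d where d: "d > 0" "\<And>z. dist x z < d \<Longrightarrow> dist (u z) (u x) < e/2"
    unfolding continuous_at_eps_delta using e by (metis dist_commute half_gt_zero)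
  have "dist (mollify S \<delta> u x) (u x) < e" if "0 < \<delta>" "\<delta> < min r d" for \<delta>
  proof -
    have sub: "cball x \<delta> \<subseteq> S" using r that by force
    have "set_integrable lborel (cball x \<delta>) u"
      unfolding set_integrable_def
      by (intro borel_integrable_compact continuous_on_subset[OF assms(2)] sub) auto
    then have "\<bar>mollify S \<delta> u x - u x\<bar> \<le> e/2"
      using d that by (intro mollify_near sub AE_I2) (auto simp: dist_real_def intro!: less_imp_le)
    then show ?thesis using e by (simp add: dist_real_def)
  qed
  then show "\<forall>\<^sub>F \<delta> in at_right 0. dist (mollify S \<delta> u x) (u x) < e"
    unfolding eventually_at_right_field using r d by (intro exI[of _ "min r d"]) auto
qed

text \<open>Differentiation under the integral sign. The quadratic remainder of the kernel is integrated
  directly against \<open>\<bar>u\<bar>\<close>, so local integrability of \<open>u\<close> suffices. The radius \<open>2 * \<delta>\<close>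
  leaves room to move the centre by \<open>\<delta>\<close> while the kernel stays supported in a fixed compact
  subset of \<open>S\<close>.\<close>

lemma has_derivative_mollify_integral:
  fixes u :: "'a::euclidean_space \<Rightarrow> real"
  assumes "locally_integrable S u" "cball x (2 * \<delta>) \<subseteq> S" "\<delta> > 0"
  shows "(mollify S \<delta> u has_derivative
           (\<lambda>h. LINT z:S|lborel. u z * (mollifier_grad \<delta> (x - z) \<bullet> h))) (at x)"
proof -
  let ?K = "cball x (2 * \<delta>)"
  let ?D = "\<lambda>h. LINT z:S|lborel. u z * (mollifier_grad \<delta> (x - z) \<bullet> h)"
  obtain L where L: "\<And>w h. \<bar>mollifier \<delta> (w + h) - mollifier \<delta> w - mollifier_grad \<delta> w \<bullet> h\<bar> \<le> L * (norm (h::'a))\<^sup>2"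
    using mollifier_taylor[OF assms(3)] by blast
  have u: "set_integrable lborel ?K u"
    using assms unfolding locally_integrable_def by auto
  have reduce: "(LINT z:S|lborel. u z * p z) = (LINT z:?K|lborel. u z * p z)"
    if "\<And>z. z \<notin> ?K \<Longrightarrow> p z = 0" for p
    by (rule set_integral_support[OF assms(2)]) (use that in simp)
  have int: "set_integrable lborel ?K (\<lambda>z. u z * p z)" if "continuous_on UNIV p" for p
    by (rule set_integrable_mult_continuous[OF u _ that]) auto
  have Dred: "?D h = (LINT z:?K|lborel. u z * (mollifier_grad \<delta> (x - z) \<bullet> h))" for h
    using assms(3) by (intro reduce) (simp add: mollifier_grad_eq_0 dist_norm)
  have Dint: "set_integrable lborel ?K (\<lambda>z. u z * (mollifier_grad \<delta> (x - z) \<bullet> h))" for h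
    by (intro int continuous_intros)
  have Dlin: "linear ?D"
  proof (rule linearI)
    fix h k
    show "?D (h + k) = ?D h + ?D k"
      unfolding Dred using set_integral_add(2)[OF Dint Dint, of h k]
      by (simp add: inner_add_right distrib_left)
  next
    fix h :: 'a and c :: real
    show "?D (c *\<^sub>R h) = c *\<^sub>R ?D h"
      unfolding Dred by (simp add: mult.left_commute)
  qed
  define A where "A = (LINT z:?K|lborel. \<bar>u z\<bar>)"
  have est: "\<bar>mollify S \<delta> u (x + h) - mollify S \<delta> u x - ?D h\<bar> \<le> (L * A) * (norm h)\<^sup>2"
    if h: "norm h \<le> \<delta>" for h
  proof -
    have "mollify S \<delta> u (x + h) = (LINT z:?K|lborel. u z * mollifier \<delta> (x + h - z))"
      unfolding mollify_def
    proof (rule reduce)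
      fix z assume "z \<notin> ?K"
      then have "norm (x + h - z) \<ge> \<delta>"
        using h norm_triangle_ineq4[of "x + h - z" h] by (simp add: dist_norm)
      then show "mollifier \<delta> (x + h - z) = 0" using assms(3) by (rule mollifier_eq_0[rotated])
    qed
    moreover have "mollify S \<delta> u x = (LINT z:?K|lborel. u z * mollifier \<delta> (x - z))"
      unfolding mollify_def using assms(3) by (intro reduce) (simp add: mollifier_eq_0 dist_norm)
    moreover note Dred
    ultimately have "mollify S \<delta> u (x + h) - mollify S \<delta> u x - ?D h
      = (LINT z:?K|lborel. u z * mollifier \<delta> (x + h - z) - u z * mollifier \<delta> (x - z)
           - u z * (mollifier_grad \<delta> (x - z) \<bullet> h))"
      by (subst set_integral_diff, intro set_integral_diff int continuous_intros, intro int continuous_intros)+ simp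
    also have "\<bar>\<dots>\<bar> \<le> (LINT z:?K|lborel. \<bar>u z\<bar> * (L * (norm h)\<^sup>2))"
      unfolding set_lebesgue_integral_def
    proof (rule integral_abs_bound_integral)
      show "integrable lborel (\<lambda>z. indicator ?K z *\<^sub>R (u z * mollifier \<delta> (x + h - z) - u z * mollifier \<delta> (x - z)
           - u z * (mollifier_grad \<delta> (x - z) \<bullet> h)))"
        unfolding set_integrable_def[symmetric] by (intro set_integral_diff int continuous_intros)
      show "integrable lborel (\<lambda>z. indicator ?K z *\<^sub>R (\<bar>u z\<bar> * (L * (norm h)\<^sup>2)))"
        unfolding set_integrable_def[symmetric] using u by (intro set_integrable_mult_left set_integrable_abs)
      fix z
      have "\<bar>u z * mollifier \<delta> (x + h - z) - u z * mollifier \<delta> (x - z) - u z * (mollifier_grad \<delta> (x - z) \<bullet> h)\<bar>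
          = \<bar>u z\<bar> * \<bar>mollifier \<delta> ((x - z) + h) - mollifier \<delta> (x - z) - mollifier_grad \<delta> (x - z) \<bullet> h\<bar>"
        unfolding abs_mult[symmetric] by (simp add: algebra_simps)
      also have "\<dots> \<le> \<bar>u z\<bar> * (L * (norm h)\<^sup>2)"
        by (intro mult_left_mono L) auto
      finally show "\<bar>indicator ?K z *\<^sub>R (u z * mollifier \<delta> (x + h - z) - u z * mollifier \<delta> (x - z)
           - u z * (mollifier_grad \<delta> (x - z) \<bullet> h))\<bar> \<le> indicator ?K z *\<^sub>R (\<bar>u z\<bar> * (L * (norm h)\<^sup>2))"
        by (simp add: indicator_def)
    qed
    also have "\<dots> = (L * A) * (norm h)\<^sup>2" by (simp add: A_def)
    finally show ?thesis .
  qed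
  show ?thesis
    unfolding has_derivative_at
  proof
    show "bounded_linear ?D" using Dlin by (rule linear_conv_bounded_linear[THEN iffD1])
    show "(\<lambda>h. norm (mollify S \<delta> u (x + h) - mollify S \<delta> u x - ?D h) / norm h) \<midarrow>0\<rightarrow> 0"
    proof (rule Lim_null_comparison)
      show "\<forall>\<^sub>F h in at 0. norm (norm (mollify S \<delta> u (x + h) - mollify S \<delta> u x - ?D h) / norm h) \<le> (L * A) * norm h"
        unfolding eventually_at
      proof (intro exI[of _ \<delta>] conjI assms(3) ballI impI)
        fix h :: 'a assume h: "h \<noteq> 0 \<and> dist h 0 < \<delta>"
        then have "\<bar>mollify S \<delta> u (x + h) - mollify S \<delta> u x - ?D h\<bar> \<le> (L * A * norm h) * norm h"
          using est[of h] by (simp add: power2_eq_square mult.assoc)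
        then show "norm (norm (mollify S \<delta> u (x + h) - mollify S \<delta> u x - ?D h) / norm h) \<le> (L * A) * norm h"
          using h by (simp add: divide_le_eq)
      qed
      show "(\<lambda>h. (L * A) * norm h) \<midarrow>0\<rightarrow> 0"
        by (auto intro!: tendsto_eq_intros)
    qed
  qed
qed

lemma test_function_mollifier:
  fixes x :: "'a::euclidean_space"
  assumes "cball x \<delta> \<subseteq> S" "\<delta> > 0"
  shows "test_function S (\<lambda>z. mollifier \<delta> (x - z))"
    and "frechet_derivative (\<lambda>z. mollifier \<delta> (x - z)) (at z) i = - (mollifier_grad \<delta> (x - z) \<bullet> i)"
proof -
  have D: "((\<lambda>z. mollifier \<delta> (x - z)) has_derivative (\<lambda>k. - (mollifier_grad \<delta> (x - z) \<bullet> k))) (at z)" for z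
  proof -
    have "((\<lambda>z. x - z) has_derivative (\<lambda>k. - k)) (at z)"
      by (auto intro!: derivative_eq_intros)
    from has_derivative_compose[OF this has_derivative_mollifier[of \<delta> "x - z"]]
    show ?thesis by simp
  qed
  have F: "frechet_derivative (\<lambda>z. mollifier \<delta> (x - z)) (at z) = (\<lambda>k. - (mollifier_grad \<delta> (x - z) \<bullet> k))" for z
    by (rule frechet_derivative_at[OF D, symmetric])
  then show "frechet_derivative (\<lambda>z. mollifier \<delta> (x - z)) (at z) i = - (mollifier_grad \<delta> (x - z) \<bullet> i)"
    by simp
  have sub: "closure {z. mollifier \<delta> (x - z) \<noteq> 0} \<subseteq> cball x \<delta>"
    using mollifier_eq_0[OF assms(2)] by (intro closure_minimal) (force simp: dist_norm)+
  show "test_function S (\<lambda>z. mollifier \<delta> (x - z))"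
    unfolding test_function_def F
  proof (intro conjI allI ballI)
    show "(\<lambda>z. mollifier \<delta> (x - z)) differentiable at z" for z using D differentiable_def by blast
    show "compact (closure {z. mollifier \<delta> (x - z) \<noteq> 0})"
      using bounded_subset[OF bounded_cball sub] by (simp add: compact_eq_bounded_closed)
  qed (use sub assms(1) in \<open>auto intro!: continuous_intros\<close>)
qed

text \<open>The reflected and translated kernel is an admissible test function; its derivative carries
  a minus sign, which cancels the one from integration by parts.\<close>

lemma weak_deriv_mollifier:
  fixes x :: "'a::euclidean_space"
  assumes "weak_deriv S i u g" "cball x \<delta> \<subseteq> S" "\<delta> > 0"
  shows "(LINT z:S|lborel. u z * (mollifier_grad \<delta> (x - z) \<bullet> i)) = mollify S \<delta> g x"
  using assms(1) test_function_mollifier[OF assms(2,3)]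
  unfolding weak_deriv_def mollify_def by (force simp: set_lebesgue_integral_def)

text \<open>Mollification commutes with weak differentiation. This turns every almost-everywhere bound
  on weak derivatives into a pointwise bound on classical ones, with a constant that does not
  depend on \<open>\<delta>\<close>.\<close>

lemma has_derivative_mollify:
  fixes u :: "'a::euclidean_space \<Rightarrow> real"
  assumes wd: "\<And>i. i \<in> Basis \<Longrightarrow> weak_deriv S i u (g i)"
    and "cball x (2 * \<delta>) \<subseteq> S" "\<delta> > 0"
  shows "(mollify S \<delta> u has_derivative
           (\<lambda>h. (\<Sum>i\<in>Basis. mollify S \<delta> (g i) x *\<^sub>R i) \<bullet> h)) (at x)"
proof -
  let ?D = "\<lambda>h. LINT z:S|lborel. u z * (mollifier_grad \<delta> (x - z) \<bullet> h)"
  have sub: "cball x \<delta> \<subseteq> S" using assms(2,3) by force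
  have D: "(mollify S \<delta> u has_derivative ?D) (at x)"
    using wd[OF SOME_Basis] assms(2,3) by (intro has_derivative_mollify_integral) (auto simp: weak_deriv_def)
  then interpret bounded_linear ?D by (rule has_derivative_bounded_linear)
  have "?D h = (\<Sum>i\<in>Basis. mollify S \<delta> (g i) x *\<^sub>R i) \<bullet> h" for h
  proof -
    have "?D h = ?D (\<Sum>i\<in>Basis. (h \<bullet> i) *\<^sub>R i)" by (simp only: euclidean_representation)
    also have "\<dots> = (\<Sum>i\<in>Basis. (h \<bullet> i) *\<^sub>R ?D i)" by (simp only: sum scaleR)
    also have "\<dots> = (\<Sum>i\<in>Basis. (h \<bullet> i) *\<^sub>R mollify S \<delta> (g i) x)"
      by (intro sum.cong refl arg_cong2[where f = scaleR] weak_deriv_mollifier[OF wd sub assms(3)])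
    finally show ?thesis by (simp add: inner_sum_left inner_sum_right inner_commute[of _ h] mult.commute)
  qed
  then show ?thesis using D by simp
qed

section \<open>Sobolev functions with exponent infinity are classically regular\<close>

lemma W_infty_imp_L_infty: "W_infty k S f \<Longrightarrow> L_infty S f"
  by (cases k) auto

lemma W_infty_SucE:
  assumes "W_infty (Suc k) S u"
  obtains g M where "M \<ge> 0"
    "\<And>i. i \<in> Basis \<Longrightarrow> weak_deriv S i u (g i)"
    "\<And>i. i \<in> Basis \<Longrightarrow> W_infty k S (g i)"
    "\<And>i. i \<in> Basis \<Longrightarrow> AE z in lborel. z \<in> S \<longrightarrow> \<bar>g i z\<bar> \<le> M"
proof -
  obtain g where g: "\<And>i. i \<in> Basis \<Longrightarrow> weak_deriv S i u (g i)" "\<And>i. i \<in> Basis \<Longrightarrow> W_infty k S (g i)"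
    using assms by simp metis
  have "\<exists>M. AE z in lborel. z \<in> S \<longrightarrow> \<bar>g i z\<bar> \<le> M" if "i \<in> Basis" for i
    using W_infty_imp_L_infty[OF g(2)[OF that]] by (simp add: L_infty_def)
  then obtain M where M: "\<And>i. i \<in> Basis \<Longrightarrow> AE z in lborel. z \<in> S \<longrightarrow> \<bar>g i z\<bar> \<le> M i"
    by metis
  have le: "M i \<le> (\<Sum>i\<in>Basis. \<bar>M i\<bar>)" if "i \<in> Basis" for i
    using member_le_sum[of i Basis "\<lambda>i. \<bar>M i\<bar>"] that by auto
  then have "AE z in lborel. z \<in> S \<longrightarrow> \<bar>g i z\<bar> \<le> (\<Sum>i\<in>Basis. \<bar>M i\<bar>)" if "i \<in> Basis" for i
    using M[OF that] by eventually_elim (use le[OF that] in auto)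
  with g show ?thesis by (intro that[of "\<Sum>i\<in>Basis. \<bar>M i\<bar>" g]) (auto intro: sum_nonneg)
qed

lemma convex_inner_points:
  assumes "convex (S::'a::real_normed_vector set)"
  shows "convex {x. cball x r \<subseteq> S}"
proof (rule convexI, clarify)
  fix x y p :: 'a and u v :: real
  assume x: "cball x r \<subseteq> S" and y: "cball y r \<subseteq> S" and uv: "0 \<le> u" "0 \<le> v" "u + v = 1"
    and p: "p \<in> cball (u *\<^sub>R x + v *\<^sub>R y) r"
  define d where "d = p - (u *\<^sub>R x + v *\<^sub>R y)"
  have "norm d \<le> r" using p by (simp add: d_def dist_norm norm_minus_commute)
  then have "x + d \<in> S" "y + d \<in> S" using x y by (auto simp: dist_norm subset_iff)
  then have "u *\<^sub>R (x + d) + v *\<^sub>R (y + d) \<in> S" using assms uv by (simp add: convexD)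
  moreover have "u *\<^sub>R (x + d) + v *\<^sub>R (y + d) = u *\<^sub>R x + v *\<^sub>R y + (u + v) *\<^sub>R d"
    by (simp add: algebra_simps)
  ultimately show "p \<in> S" using uv by (simp add: d_def)
qed

lemma eventually_inner_point:
  assumes "open S" "x \<in> S"
  shows "\<forall>\<^sub>F \<delta> in at_right 0. 0 < \<delta> \<and> cball x (2 * \<delta>) \<subseteq> S"
proof -
  obtain r where r: "r > 0" "cball x r \<subseteq> S" using assms open_contains_cball by blast
  show ?thesis unfolding eventually_at_right_field
    using r by (intro exI[of _ "r/2"]) auto
qed

lemma set_integrable_weak_deriv:
  assumes "weak_deriv S i u g" "cball x \<delta> \<subseteq> S"
  shows "set_integrable lborel (cball x \<delta>) g"
  using assms by (auto simp: weak_deriv_def locally_integrable_def)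

lemma norm_mollify_gradient:
  fixes g :: "'a::euclidean_space \<Rightarrow> 'a \<Rightarrow> real" and M :: real
  assumes "\<And>i. i \<in> Basis \<Longrightarrow> weak_deriv S i u (g i)"
    "\<And>i. i \<in> Basis \<Longrightarrow> AE z in lborel. z \<in> S \<longrightarrow> \<bar>g i z\<bar> \<le> M"
    "cball x (2 * \<delta>) \<subseteq> S" "\<delta> > 0"
  shows "norm (\<Sum>i\<in>Basis. mollify S \<delta> (g i) x *\<^sub>R i) \<le> DIM('a) * M"
proof -
  have sub: "cball x \<delta> \<subseteq> S" using assms(3,4) by force
  have "norm (\<Sum>i\<in>Basis. mollify S \<delta> (g i) x *\<^sub>R i) \<le> (\<Sum>i\<in>(Basis::'a set). M)"
    using abs_mollify_le[OF sub assms(4) set_integrable_weak_deriv[OF assms(1) sub] assms(2)]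
    by (intro sum_norm_le) auto
  then show ?thesis by simp
qed

text \<open>The Lipschitz constant is independent of \<open>\<delta>\<close>. It applies to possibly discontinuous functions,
  in particular to the weak derivatives of a function in \<open>W_infty 2\<close>.\<close>

lemma mollify_lipschitz:
  fixes u :: "'a::euclidean_space \<Rightarrow> real"
  assumes "convex S" "W_infty (Suc k) S u"
  obtains M where "M \<ge> 0" "\<And>\<delta> x y. \<delta> > 0 \<Longrightarrow> cball x (2 * \<delta>) \<subseteq> S \<Longrightarrow> cball y (2 * \<delta>) \<subseteq> S \<Longrightarrow>
      \<bar>mollify S \<delta> u x - mollify S \<delta> u y\<bar> \<le> M * norm (x - y)"
proof -
  obtain g M where g: "M \<ge> 0"
    "\<And>i. i \<in> Basis \<Longrightarrow> weak_deriv S i u (g i)"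
    "\<And>i. i \<in> Basis \<Longrightarrow> AE z in lborel. z \<in> S \<longrightarrow> \<bar>g i z\<bar> \<le> M"
    by (rule W_infty_SucE[OF assms(2)]) blast
  show ?thesis
  proof (rule that)
    show "0 \<le> DIM('a) * M" using g by simp
    fix \<delta> :: real and x y assume \<delta>: "\<delta> > 0" and xy: "cball x (2 * \<delta>) \<subseteq> S" "cball y (2 * \<delta>) \<subseteq> S"
    have "norm (mollify S \<delta> u x - mollify S \<delta> u y) \<le> DIM('a) * M * norm (x - y)"
    proof (rule differentiable_bound[OF convex_inner_points[OF assms(1), of "2 * \<delta>"]])
      fix z assume z: "z \<in> {x. cball x (2 * \<delta>) \<subseteq> S}"
      show "(mollify S \<delta> u has_derivative (\<lambda>h. (\<Sum>i\<in>Basis. mollify S \<delta> (g i) z *\<^sub>R i) \<bullet> h)) (at z within {x. cball x (2 * \<delta>) \<subseteq> S})"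
        using z by (intro has_derivative_at_withinI[OF has_derivative_mollify[OF g(2) _ \<delta>]]) auto
      have "norm (\<Sum>i\<in>Basis. mollify S \<delta> (g i) z *\<^sub>R i) \<le> DIM('a) * M"
        using z by (intro norm_mollify_gradient[OF g(2,3) _ \<delta>]) auto
      then show "onorm ((\<bullet>) (\<Sum>i\<in>Basis. mollify S \<delta> (g i) z *\<^sub>R i)) \<le> DIM('a) * M"
        unfolding real_norm_def
        by (intro onorm_le) (auto intro: order_trans[OF Cauchy_Schwarz_ineq2 mult_right_mono])
    qed (use xy in auto)
    then show "\<bar>mollify S \<delta> u x - mollify S \<delta> u y\<bar> \<le> DIM('a) * M * norm (x - y)" by simp
  qed
qed

text \<open>Let \<open>\<delta>\<close> tend to zero in the uniform Lipschitz bound. Continuity up to the closure makes the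
  bound reach the boundary of \<open>S\<close>.\<close>

lemma W_infty_imp_lipschitz:
  fixes u :: "'a::euclidean_space \<Rightarrow> real"
  assumes "open S" "convex S" "W_infty (Suc k) S u" "continuous_on (closure S) u"
  shows "\<exists>L. L-lipschitz_on (closure S) u"
proof -
  have cont: "continuous_on S u" by (rule continuous_on_subset[OF assms(4) closure_subset])
  obtain M where M: "M \<ge> 0" "\<And>\<delta> x y. \<delta> > 0 \<Longrightarrow> cball x (2 * \<delta>) \<subseteq> S \<Longrightarrow> cball y (2 * \<delta>) \<subseteq> S \<Longrightarrow>
      \<bar>mollify S \<delta> u x - mollify S \<delta> u y\<bar> \<le> M * norm (x - y)"
    using mollify_lipschitz[OF assms(2,3)] by metis
  have "M-lipschitz_on S u"
  proof (rule lipschitz_onI)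
    fix x y assume xy: "x \<in> S" "y \<in> S"
    have "\<bar>u x - u y\<bar> \<le> M * norm (x - y)"
    proof (rule tendsto_upperbound)
      show "((\<lambda>\<delta>. \<bar>mollify S \<delta> u x - mollify S \<delta> u y\<bar>) \<longlongrightarrow> \<bar>u x - u y\<bar>) (at_right 0)"
        by (intro tendsto_intros tendsto_mollify assms(1) cont xy)
      show "\<forall>\<^sub>F \<delta> in at_right 0. \<bar>mollify S \<delta> u x - mollify S \<delta> u y\<bar> \<le> M * norm (x - y)"
        using eventually_inner_point[OF assms(1) xy(1)] eventually_inner_point[OF assms(1) xy(2)]
        by eventually_elim (use M in auto)
    qed simp
    then show "dist (u x) (u y) \<le> M * dist x y" by (simp add: dist_norm)
  qed (rule M)
  then show ?thesis using assms(4) lipschitz_on_closure by blast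
qed

lemma L_infty_imp_bounded:
  fixes u :: "'a::euclidean_space \<Rightarrow> real"
  assumes "open S" "L_infty S u" "continuous_on (closure S) u"
  shows "\<exists>M. \<forall>x\<in>closure S. \<bar>u x\<bar> \<le> M"
proof -
  have cont: "continuous_on S u" by (rule continuous_on_subset[OF assms(3) closure_subset])
  obtain M where M: "AE z in lborel. z \<in> S \<longrightarrow> \<bar>u z\<bar> \<le> M" using assms(2) by (auto simp: L_infty_def)
  have bound: "\<bar>u x\<bar> \<le> M" if "x \<in> S" for x
  proof (rule tendsto_upperbound)
    show "((\<lambda>\<delta>. \<bar>mollify S \<delta> u x\<bar>) \<longlongrightarrow> \<bar>u x\<bar>) (at_right 0)"
      by (intro tendsto_intros tendsto_mollify assms(1) cont that)
    show "\<forall>\<^sub>F \<delta> in at_right 0. \<bar>mollify S \<delta> u x\<bar> \<le> M"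
      using eventually_inner_point[OF assms(1) that]
    proof eventually_elim
      case (elim \<delta>)
      then have "cball x \<delta> \<subseteq> S" by force
      then show ?case using elim M
        by (intro abs_mollify_le)
          (auto simp: set_integrable_def simp del: real_scaleR_def intro!: borel_integrable_compact continuous_on_subset[OF cont])
    qed
  qed simp
 have "\<bar>u x\<bar> \<le> M" if "x \<in> closure S" for x
    by (rule continuous_le_on_closure[where f = "\<lambda>x. \<bar>u x\<bar>", OF _ that])
      (use bound in \<open>auto intro!: continuous_intros assms\<close>)
  then show ?thesis by auto
qed

lemma quadratic_remainder_imp_has_derivative:
  fixes u :: "'a::real_inner \<Rightarrow> real"
  assumes "open S" "x \<in> S" "\<And>z. z \<in> S \<Longrightarrow> \<bar>u z - u x - g \<bullet> (z - x)\<bar> \<le> L * (norm (z - x))\<^sup>2"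
  shows "(u has_derivative (\<lambda>h. g \<bullet> h)) (at x)"
  unfolding has_derivative_at
proof
  show "bounded_linear ((\<bullet>) g)" by (rule bounded_linear_inner_right)
  show "(\<lambda>h. norm (u (x + h) - u x - g \<bullet> h) / norm h) \<midarrow>0\<rightarrow> 0"
  proof (rule Lim_null_comparison)
    obtain r where r: "r > 0" "ball x r \<subseteq> S" using assms(1,2) open_contains_ball by blast
    show "\<forall>\<^sub>F h in at 0. norm (norm (u (x + h) - u x - g \<bullet> h) / norm h) \<le> L * norm h"
      unfolding eventually_at
    proof (intro exI[of _ r] conjI r ballI impI)
      fix h :: 'a assume h: "h \<noteq> 0 \<and> dist h 0 < r"
      then have "x + h \<in> S" using r by (auto simp: dist_norm subset_iff)
      from assms(3)[OF this] show "norm (norm (u (x + h) - u x - g \<bullet> h) / norm h) \<le> L * norm h"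
        using h by (simp add: divide_le_eq power2_eq_square mult.assoc)
    qed
    show "(\<lambda>h. L * norm h) \<midarrow>0\<rightarrow> 0" by (auto intro!: tendsto_eq_intros)
  qed
qed

lemma has_derivative_inner_unique:
  assumes "(u has_derivative (\<lambda>h. g \<bullet> h)) (at x)" "(u has_derivative (\<lambda>h. g' \<bullet> h)) (at x)"
  shows "g = g'"
  using has_derivative_unique[OF assms] by (metis inner_eq_zero_iff inner_diff_left right_minus_eq)

text \<open>The mollified functions have gradients that are bounded and Lipschitz uniformly in \<open>\<delta>\<close>,
  hence satisfy a Taylor estimate with uniform quadratic remainder. At two given points the
  gradients converge along a common subsequence, and the estimate passes to the limit. Treating
  two points at once makes the Lipschitz bound survive as well, although the subsequence depends
  on the points.\<close>

lemma W_infty_2_taylor_pair: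
  fixes u :: "'a::euclidean_space \<Rightarrow> real"
  assumes "open S" "convex S" "W_infty (Suc (Suc k)) S u" "continuous_on S u"
  obtains L M where "L \<ge> 0"
   "\<And>x y. x \<in> S \<Longrightarrow> y \<in> S \<Longrightarrow> \<exists>p q. norm p \<le> M \<and> norm (p - q) \<le> L * norm (x - y) \<and>
      (\<forall>z\<in>S. \<bar>u z - u x - p \<bullet> (z - x)\<bar> \<le> L * (norm (z - x))\<^sup>2) \<and>
      (\<forall>z\<in>S. \<bar>u z - u y - q \<bullet> (z - y)\<bar> \<le> L * (norm (z - y))\<^sup>2)"
proof -
  obtain g M where g: "M \<ge> 0"
    "\<And>i. i \<in> Basis \<Longrightarrow> weak_deriv S i u (g i)"
    "\<And>i. i \<in> Basis \<Longrightarrow> W_infty (Suc k) S (g i)"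
    "\<And>i. i \<in> Basis \<Longrightarrow> AE z in lborel. z \<in> S \<longrightarrow> \<bar>g i z\<bar> \<le> M"
    by (rule W_infty_SucE[OF assms(3)]) blast
  define K where "K = DIM('a) * M"
  have "\<exists>L. L \<ge> 0 \<and> (\<forall>\<delta>>0. \<forall>x y. cball x (2 * \<delta>) \<subseteq> S \<longrightarrow> cball y (2 * \<delta>) \<subseteq> S \<longrightarrow>
      \<bar>mollify S \<delta> (g i) x - mollify S \<delta> (g i) y\<bar> \<le> L * norm (x - y))" if "i \<in> Basis" for i
    by (rule mollify_lipschitz[OF assms(2) g(3)[OF that]]) blast
  then obtain l where l: "\<And>i. i \<in> Basis \<Longrightarrow> l i \<ge> 0" "\<And>i \<delta> x y. i \<in> Basis \<Longrightarrow> \<delta> > 0 \<Longrightarrow> 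
      cball x (2 * \<delta>) \<subseteq> S \<Longrightarrow> cball y (2 * \<delta>) \<subseteq> S \<Longrightarrow>
      \<bar>mollify S \<delta> (g i) x - mollify S \<delta> (g i) y\<bar> \<le> l i * norm (x - y)"
    by metis
  define L where "L = (\<Sum>i\<in>Basis. l i)"
  have L: "L \<ge> 0" by (auto simp: L_def intro: sum_nonneg l)
  define G where "G \<delta> x = (\<Sum>i\<in>Basis. mollify S \<delta> (g i) x *\<^sub>R i)" for \<delta> x
  have G_lip: "norm (G \<delta> x - G \<delta> y) \<le> L * norm (x - y)"
    if "\<delta> > 0" "cball x (2 * \<delta>) \<subseteq> S" "cball y (2 * \<delta>) \<subseteq> S" for \<delta> x y
  proof -
    have "norm (G \<delta> x - G \<delta> y) = norm (\<Sum>i\<in>Basis. (mollify S \<delta> (g i) x - mollify S \<delta> (g i) y) *\<^sub>R i)"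
      by (simp add: G_def sum_subtractf[symmetric] scaleR_diff_left)
    also have "\<dots> \<le> (\<Sum>i\<in>Basis. l i * norm (x - y))"
      using l(2) that by (intro sum_norm_le) auto
    finally show ?thesis by (simp add: L_def sum_distrib_right)
  qed
  have G_bound: "norm (G \<delta> x) \<le> K" if "\<delta> > 0" "cball x (2 * \<delta>) \<subseteq> S" for \<delta> x
    unfolding G_def K_def using that by (intro norm_mollify_gradient[OF g(2,4)]) auto
  have taylor: "\<bar>mollify S \<delta> u z - mollify S \<delta> u x - G \<delta> x \<bullet> (z - x)\<bar> \<le> L * (norm (z - x))\<^sup>2"
    if "\<delta> > 0" "cball x (2 * \<delta>) \<subseteq> S" "cball z (2 * \<delta>) \<subseteq> S" for \<delta> x z
  proof -
    have seg: "cball p (2 * \<delta>) \<subseteq> S" if "p \<in> closed_segment x z" for p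
      using convex_contains_segment[of "{x. cball x (2 * \<delta>) \<subseteq> S}"] convex_inner_points[OF assms(2)]
        \<open>cball x (2 * \<delta>) \<subseteq> S\<close> \<open>cball z (2 * \<delta>) \<subseteq> S\<close> that by blast
    have "norm (mollify S \<delta> u z - mollify S \<delta> u x - G \<delta> x \<bullet> (z - x)) \<le> norm (z - x) * (L * norm (z - x))"
    proof (rule differentiable_bound_linearization[where S = "closed_segment x z" and f' = "\<lambda>p h. G \<delta> p \<bullet> h"])
      show "x + t *\<^sub>R (z - x) \<in> closed_segment x z" if "t \<in> {0..1}" for t
        using that by (auto simp: closed_segment_def algebra_simps intro!: exI[of _ t])
      fix p assume p: "p \<in> closed_segment x z"
      show "(mollify S \<delta> u has_derivative (\<bullet>) (G \<delta> p)) (at p within closed_segment x z)"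
        unfolding G_def
        by (rule has_derivative_at_withinI[OF has_derivative_mollify[OF g(2) seg[OF p] that(1)]])
      show "onorm ((\<bullet>) (G \<delta> p) - (\<bullet>) (G \<delta> x)) \<le> L * norm (z - x)"
      proof (rule onorm_le)
        fix h :: 'a
        have "norm (G \<delta> p - G \<delta> x) \<le> L * norm (p - x)" by (intro G_lip that seg p)
        also have "\<dots> \<le> L * norm (z - x)"
          using p L by (intro mult_left_mono) (auto simp: segment_bound)
        finally have "norm (G \<delta> p - G \<delta> x) * norm h \<le> L * norm (z - x) * norm h"
          by (rule mult_right_mono) auto
        then show "norm (((\<bullet>) (G \<delta> p) - (\<bullet>) (G \<delta> x)) h) \<le> L * norm (z - x) * norm h"
          using Cauchy_Schwarz_ineq2[of "G \<delta> p - G \<delta> x" h] by (simp add: inner_diff_left)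
      qed
    qed auto
    then show ?thesis by (simp add: power2_eq_square mult_ac)
  qed
  have main: "\<exists>p q. norm p \<le> K \<and> norm (p - q) \<le> L * norm (x - y) \<and>
      (\<forall>z\<in>S. \<bar>u z - u x - p \<bullet> (z - x)\<bar> \<le> L * (norm (z - x))\<^sup>2) \<and>
      (\<forall>z\<in>S. \<bar>u z - u y - q \<bullet> (z - y)\<bar> \<le> L * (norm (z - y))\<^sup>2)" if xy: "x \<in> S" "y \<in> S" for x y
  proof -
    obtain r1 r2 where r12: "r1 > 0" "cball x r1 \<subseteq> S" "r2 > 0" "cball y r2 \<subseteq> S"
      using xy assms(1) open_contains_cball by metis
    define r where "r = min r1 r2 / 2"
    define d where "d n = r / real (Suc n)" for n
    have r: "r > 0" using r12 by (simp add: r_def)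
    have d: "d n > 0" "d n \<le> r" for n
      using r by (auto simp: d_def divide_le_eq)
    have dx: "cball x (2 * d n) \<subseteq> S" and dy: "cball y (2 * d n) \<subseteq> S" for n
      using r12 d(2)[of n] by (force simp: r_def)+
    have "(\<lambda>n. r * (1 / real (Suc n))) \<longlonglongrightarrow> r * 0"
      by (intro tendsto_mult tendsto_const LIMSEQ_Suc lim_1_over_n)
    then have d_lim: "filterlim d (at_right 0) sequentially"
      using d(1) using r by (simp add: filterlim_at d_def[abs_def])
    have "bounded (range (\<lambda>n. (G (d n) x, G (d n) y)))"
      unfolding bounded_iff
    proof (intro exI[of _ "K + K"] ballI, clarify)
      fix n
      have "norm (G (d n) x, G (d n) y) \<le> norm (G (d n) x) + norm (G (d n) y)"
        by (simp add: norm_Pair sqrt_sum_squares_le_sum)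
      then show "norm (G (d n) x, G (d n) y) \<le> K + K"
        using G_bound[OF d(1)[of n] dx] G_bound[OF d(1)[of n] dy] by linarith
    qed
    then obtain pq s where s: "strict_mono (s :: nat \<Rightarrow> nat)"
      and pq: "((\<lambda>n. (G (d n) x, G (d n) y)) \<circ> s) \<longlonglongrightarrow> pq"
      using bounded_imp_convergent_subsequence by blast
    (* The pair sequence provides one subsequence that serves both points. *)
    define p q where "p = fst pq" and "q = snd pq"
    have p: "(\<lambda>n. G (d (s n)) x) \<longlonglongrightarrow> p" and q: "(\<lambda>n. G (d (s n)) y) \<longlonglongrightarrow> q"
      using tendsto_fst[OF pq] tendsto_snd[OF pq] by (simp_all add: p_def q_def o_def)
    have ds: "filterlim (\<lambda>n. d (s n)) (at_right 0) sequentially"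
      using d_lim filterlim_subseq[OF s] by (rule filterlim_compose)
    have lim_taylor: "\<bar>u z - u w - a \<bullet> (z - w)\<bar> \<le> L * (norm (z - w))\<^sup>2"
      if w: "w \<in> S" and z: "z \<in> S" and a: "(\<lambda>n. G (d (s n)) w) \<longlonglongrightarrow> a" for w z a
    proof (rule tendsto_upperbound)
      show "(\<lambda>n. \<bar>mollify S (d (s n)) u z - mollify S (d (s n)) u w - G (d (s n)) w \<bullet> (z - w)\<bar>)
         \<longlonglongrightarrow> \<bar>u z - u w - a \<bullet> (z - w)\<bar>"
        using filterlim_compose[OF tendsto_mollify[OF assms(1,4) z] ds]
          filterlim_compose[OF tendsto_mollify[OF assms(1,4) w] ds]
        by (intro tendsto_intros a)
      have "\<forall>\<^sub>F n in sequentially. 0 < d (s n) \<and> cball w (2 * d (s n)) \<subseteq> S"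
        "\<forall>\<^sub>F n in sequentially. 0 < d (s n) \<and> cball z (2 * d (s n)) \<subseteq> S"
        using eventually_compose_filterlim[OF eventually_inner_point[OF assms(1)] ds] w z by auto
      then show "\<forall>\<^sub>F n in sequentially. \<bar>mollify S (d (s n)) u z - mollify S (d (s n)) u w - G (d (s n)) w \<bullet> (z - w)\<bar>
          \<le> L * (norm (z - w))\<^sup>2"
        by eventually_elim (intro taylor, auto)
    qed simp
    have "norm p \<le> K"
      by (rule tendsto_upperbound[OF tendsto_norm[OF p]]) (auto intro!: always_eventually G_bound d dx)
    moreover have "norm (p - q) \<le> L * norm (x - y)"
      by (rule tendsto_upperbound[OF tendsto_norm[OF tendsto_diff[OF p q]]])
        (auto intro!: always_eventually G_lip d dx dy)
    ultimately show ?thesis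
      using lim_taylor[OF xy(1) _ p] lim_taylor[OF xy(2) _ q] by blast
  qed
  show ?thesis by (rule that[OF L main])
qed

text \<open>The Taylor estimate determines the gradient uniquely at points of the open set \<open>S\<close>, so the
  pointwise limits obtained from different subsequences fit together to one Lipschitz field.
  That field extends to the closure, and the Taylor estimate follows it there by continuity;
  hence derivatives along the boundary also exist in the classical sense.\<close>

lemma W_infty_2_imp_C11:
  fixes u :: "'a::euclidean_space \<Rightarrow> real"
  assumes "open S" "convex S" "W_infty (Suc (Suc k)) S u" "continuous_on (closure S) u"
  obtains G L M where "L-lipschitz_on (closure S) G" "\<And>x. x \<in> closure S \<Longrightarrow> norm (G x) \<le> M"
    "\<And>x y. x \<in> closure S \<Longrightarrow> y \<in> closure S \<Longrightarrow> \<bar>u y - u x - G x \<bullet> (y - x)\<bar> \<le> L * (norm (y - x))\<^sup>2"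
proof -
  have cont: "continuous_on S u" by (rule continuous_on_subset[OF assms(4) closure_subset])
  obtain L M where L: "L \<ge> 0" and pair:
   "\<And>x y. x \<in> S \<Longrightarrow> y \<in> S \<Longrightarrow> \<exists>p q. norm p \<le> M \<and> norm (p - q) \<le> L * norm (x - y) \<and>
      (\<forall>z\<in>S. \<bar>u z - u x - p \<bullet> (z - x)\<bar> \<le> L * (norm (z - x))\<^sup>2) \<and>
      (\<forall>z\<in>S. \<bar>u z - u y - q \<bullet> (z - y)\<bar> \<le> L * (norm (z - y))\<^sup>2)"
    using W_infty_2_taylor_pair[OF assms(1-3) cont] by blast
  have "\<exists>p. norm p \<le> M \<and> (\<forall>z\<in>S. \<bar>u z - u x - p \<bullet> (z - x)\<bar> \<le> L * (norm (z - x))\<^sup>2)" if "x \<in> S" for x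
    using pair[OF that that] by blast
  then obtain G where G: "\<And>x. x \<in> S \<Longrightarrow> norm (G x) \<le> M"
     "\<And>x z. x \<in> S \<Longrightarrow> z \<in> S \<Longrightarrow> \<bar>u z - u x - G x \<bullet> (z - x)\<bar> \<le> L * (norm (z - x))\<^sup>2"
    by metis
  have "L-lipschitz_on S G"
  proof (rule lipschitz_onI[OF _ L])
    fix x y assume xy: "x \<in> S" "y \<in> S"
    obtain p q where pq: "norm (p - q) \<le> L * norm (x - y)"
      "\<And>z. z \<in> S \<Longrightarrow> \<bar>u z - u x - p \<bullet> (z - x)\<bar> \<le> L * (norm (z - x))\<^sup>2"
      "\<And>z. z \<in> S \<Longrightarrow> \<bar>u z - u y - q \<bullet> (z - y)\<bar> \<le> L * (norm (z - y))\<^sup>2"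
      using pair[OF xy] by blast
    have "G x = p" "G y = q"
      using xy G(2) pq(2,3) assms(1) has_derivative_inner_unique quadratic_remainder_imp_has_derivative
      by metis+
    then show "dist (G x) (G y) \<le> L * dist x y" using pq(1) by (simp add: dist_norm)
  qed
  then obtain G' where G': "L-lipschitz_on (closure S) G'" "\<And>x. x \<in> S \<Longrightarrow> G' x = G x"
    using lipschitz_extend_closure by blast
  have G'_cont: "continuous_on (closure S) G'" using G'(1) by (rule lipschitz_on_continuous_on)
  have bound: "norm (G' x) \<le> M" if "x \<in> closure S" for x
    using continuous_on_norm[OF G'_cont] that by (rule continuous_le_on_closure) (use G G' in auto)
  have "\<bar>u y - u x - G' x \<bullet> (y - x)\<bar> \<le> L * (norm (y - x))\<^sup>2" if xy: "x \<in> closure S" "y \<in> closure S" for x y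
  proof -
    (* The Taylor estimate is a closed condition on the pair of points. *)
    let ?f = "\<lambda>z. \<bar>u (snd z) - u (fst z) - G' (fst z) \<bullet> (snd z - fst z)\<bar> - L * (norm (snd z - fst z))\<^sup>2"
    have "?f (x, y) \<le> 0"
    proof (rule continuous_le_on_closure[where f = ?f and S = "S \<times> S"])
      show "continuous_on (closure (S \<times> S)) ?f"
        by (auto simp: closure_Times intro!: continuous_intros
            continuous_on_compose2[OF assms(4)] continuous_on_compose2[OF G'_cont])
    qed (use xy G G' in \<open>auto simp: closure_Times\<close>)
    then show ?thesis by simp
  qed
  with bound show ?thesis by (intro that[OF G'(1)]) auto
qed

section \<open>Planar rotation and Lipschitz fields\<close>

lemma perp_nth [simp]: "perp w $ 1 = w $ 1" "perp w $ 2 = w $ 2" "perp w $ 3 = 0"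
  by (simp_all add: perp_def)

lemma rot_nth [simp]: "rot w $ 1 = - w $ 2" "rot w $ 2 = w $ 1" "rot w $ 3 = 0"
  by (simp_all add: rot_def)

lemma vec3_eqI: "x $ 1 = y $ 1 \<Longrightarrow> x $ 2 = y $ 2 \<Longrightarrow> x $ 3 = y $ 3 \<Longrightarrow> x = (y :: real^3)"
  by (simp add: vec_eq_iff forall_3)

lemma inner_vec3: "x \<bullet> y = x $ 1 * y $ 1 + x $ 2 * y $ 2 + x $ 3 * (y :: real^3) $ 3"
  by (simp add: inner_vec_def sum_3)

lemma bounded_linear_rot: "bounded_linear rot"
  by (intro linear_conv_bounded_linear[THEN iffD1] linearI vec3_eqI) simp_all

lemma perp_0 [simp]: "perp 0 = 0"
  by (intro vec3_eqI) simp_all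

lemma norm_perp_le: "norm (perp w) \<le> norm w"
  by (simp add: norm_le inner_vec3)

lemma norm_rot_le: "norm (rot w) \<le> norm w"
  by (simp add: norm_le inner_vec3)

lemma rot_rot: "rot (rot w) = - perp w"
  by (intro vec3_eqI) simp_all

lemma rot_perp: "rot (perp w) = rot w"
  by (intro vec3_eqI) simp_all

text \<open>Adding a vector orthogonal to \<open>w\<close> cannot shorten it. Because the coefficient \<open>c\<close> is arbitrary,
  the magnetic force drops out of the velocity estimate no matter how small \<open>\<epsilon>\<close> is.\<close>

lemma norm_le_norm_add_rot: "norm w \<le> norm (w + c *\<^sub>R rot (perp w))"
proof -
  have "w \<bullet> rot (perp w) = 0" by (simp add: inner_vec3)
  moreover have "0 \<le> (c * c) * (rot (perp w) \<bullet> rot (perp w))"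
    by (rule mult_nonneg_nonneg[OF zero_le_square inner_ge_zero])
  ultimately have "(norm w)\<^sup>2 \<le> (norm (w + c *\<^sub>R rot (perp w)))\<^sup>2"
    by (simp add: power2_norm_eq_inner inner_add_left inner_add_right
        inner_commute[of "rot (perp w)" w] mult.assoc)
  then show ?thesis by (rule power2_le_imp_le) simp
qed

lemma grad_perp_nth_3 [simp]: "grad_perp f x $ 3 = 0"
  by (simp add: grad_perp_def)

lemma perp_grad_perp [simp]: "perp (grad_perp f x) = grad_perp f x"
  by (intro vec3_eqI) simp_all

lemma norm_snd_le_norm: "norm (snd z) \<le> norm z"
  by (metis norm_snd_le prod.collapse)

abbreviation (input) strip :: "real \<Rightarrow> (real \<times> (real^3)) set" where
  "strip T \<equiv> {0<..<T} \<times> UNIV"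

lemma strip_open_convex_closure:
  assumes "T > 0"
  shows "open (strip T)" "convex (strip T)" "closure (strip T) = {0..T} \<times> UNIV"
  using assms by (auto simp: closure_Times open_Times convex_Times)

lemma components_lipschitz:
  fixes f :: "'a::metric_space \<Rightarrow> real^3"
  assumes "\<And>i. \<exists>L. L-lipschitz_on A (\<lambda>z. f z $ i)"
  shows "\<exists>L. L-lipschitz_on A f"
proof -
  obtain l where l: "\<And>i. (l i)-lipschitz_on A (\<lambda>z. f z $ i)" using assms by metis
  have "(\<Sum>i\<in>UNIV. l i)-lipschitz_on A f"
  proof (rule lipschitz_onI)
    fix x y assume xy: "x \<in> A" "y \<in> A"
    have "dist (f x) (f y) \<le> (\<Sum>i\<in>UNIV. \<bar>(f x - f y) $ i\<bar>)"
      unfolding dist_norm by (rule norm_le_l1_cart)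
    also have "\<dots> \<le> (\<Sum>i\<in>UNIV. l i * dist x y)"
      using lipschitz_onD[OF l xy] by (intro sum_mono) (simp add: dist_real_def)
    finally show "dist (f x) (f y) \<le> (\<Sum>i\<in>UNIV. l i) * dist x y" by (simp add: sum_distrib_right)
  qed (auto intro!: sum_nonneg lipschitz_on_nonneg[OF l])
  then show ?thesis by blast
qed

lemma components_bounded:
  fixes f :: "'a \<Rightarrow> real^3"
  assumes "\<And>i. \<exists>M. \<forall>z\<in>A. \<bar>f z $ i\<bar> \<le> M"
  shows "\<exists>M. \<forall>z\<in>A. norm (f z) \<le> M"
proof -
  obtain m where m: "\<And>i z. z \<in> A \<Longrightarrow> \<bar>f z $ i\<bar> \<le> m i" using assms by metis
  have "norm (f z) \<le> (\<Sum>i\<in>UNIV. m i)" if "z \<in> A" for z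
    by (rule order_trans[OF norm_le_l1_cart sum_mono]) (use m that in auto)
  then show ?thesis by blast
qed

text \<open>Boundedness is carried along because a product of Lipschitz functions is Lipschitz only
  when both factors are bounded.\<close>

definition lipschitz_bounded :: "'a::metric_space set \<Rightarrow> ('a \<Rightarrow> 'b::real_normed_vector) \<Rightarrow> bool" where
  "lipschitz_bounded A f \<longleftrightarrow> (\<exists>L. L-lipschitz_on A f) \<and> (\<exists>M. \<forall>z\<in>A. norm (f z) \<le> M)"

lemma lipschitz_bounded_scaleR:
  fixes f :: "'a::metric_space \<Rightarrow> real" and g :: "'a \<Rightarrow> 'b::real_normed_vector"
  assumes f: "lipschitz_bounded A f" and g: "lipschitz_bounded A g"
  shows "lipschitz_bounded A (\<lambda>z. f z *\<^sub>R g z)"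
proof -
  obtain Lf Mf where 1: "Lf-lipschitz_on A f" "\<And>z. z \<in> A \<Longrightarrow> \<bar>f z\<bar> \<le> Mf"
    using f unfolding lipschitz_bounded_def real_norm_def by blast
  obtain Lg Mg where 2: "Lg-lipschitz_on A g" "\<And>z. z \<in> A \<Longrightarrow> norm (g z) \<le> Mg"
    using g unfolding lipschitz_bounded_def by blast
  have "(\<bar>Mf\<bar> * Lg + Lf * \<bar>Mg\<bar>)-lipschitz_on A (\<lambda>z. f z *\<^sub>R g z)"
  proof (rule lipschitz_onI)
    fix x y assume xy: "x \<in> A" "y \<in> A"
    have "dist (f x *\<^sub>R g x) (f y *\<^sub>R g y) = norm (f x *\<^sub>R (g x - g y) + (f x - f y) *\<^sub>R g y)"
      by (simp add: dist_norm algebra_simps)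
    also have "\<dots> \<le> \<bar>f x\<bar> * norm (g x - g y) + \<bar>f x - f y\<bar> * norm (g y)"
      by (rule order_trans[OF norm_triangle_ineq]) simp
    also have "\<dots> \<le> \<bar>Mf\<bar> * (Lg * dist x y) + (Lf * dist x y) * \<bar>Mg\<bar>"
      using 1(2)[OF xy(1)] 2(2)[OF xy(2)] lipschitz_onD[OF 1(1) xy] lipschitz_onD[OF 2(1) xy]
      by (intro add_mono mult_mono) (auto simp: dist_norm lipschitz_on_nonneg[OF 1(1)])
    finally show "dist (f x *\<^sub>R g x) (f y *\<^sub>R g y) \<le> (\<bar>Mf\<bar> * Lg + Lf * \<bar>Mg\<bar>) * dist x y"
      by (simp add: algebra_simps)
  qed (use lipschitz_on_nonneg[OF 1(1)] lipschitz_on_nonneg[OF 2(1)] in simp)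
  moreover have "norm (f z *\<^sub>R g z) \<le> \<bar>Mf\<bar> * \<bar>Mg\<bar>" if "z \<in> A" for z
    using 1(2)[OF that] 2(2)[OF that] by (auto intro!: mult_mono)
  ultimately show ?thesis unfolding lipschitz_bounded_def by blast
qed

lemma lipschitz_bounded_mult:
  fixes f g :: "'a::metric_space \<Rightarrow> real"
  shows "lipschitz_bounded A f \<Longrightarrow> lipschitz_bounded A g \<Longrightarrow> lipschitz_bounded A (\<lambda>z. f z * g z)"
  using lipschitz_bounded_scaleR[of A f g] by simp

lemma lipschitz_bounded_add:
  assumes "lipschitz_bounded A f" "lipschitz_bounded A g"
  shows "lipschitz_bounded A (\<lambda>z. f z + g z)"
proof -
  obtain L M L' M' where f: "L-lipschitz_on A f" "\<And>z. z \<in> A \<Longrightarrow> norm (f z) \<le> M"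
    and g: "L'-lipschitz_on A g" "\<And>z. z \<in> A \<Longrightarrow> norm (g z) \<le> M'"
    using assms unfolding lipschitz_bounded_def by blast
  have "norm (f z + g z) \<le> M + M'" if "z \<in> A" for z
    by (rule order_trans[OF norm_triangle_ineq add_mono[OF f(2)[OF that] g(2)[OF that]]])
  then show ?thesis
    unfolding lipschitz_bounded_def using lipschitz_on_add[OF f(1) g(1)] by blast
qed

lemma lipschitz_bounded_const: "lipschitz_bounded A (\<lambda>z. c)"
  unfolding lipschitz_bounded_def by (auto intro: lipschitz_on_constant)

lemma lipschitz_bounded_compose:
  assumes "lipschitz_bounded B f" "1-lipschitz_on A g" "g ` A \<subseteq> B"
  shows "lipschitz_bounded A (\<lambda>z. f (g z))"
proof -
  obtain L M where f: "L-lipschitz_on B f" "\<And>z. z \<in> B \<Longrightarrow> norm (f z) \<le> M"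
    using assms(1) unfolding lipschitz_bounded_def by blast
  have "norm (f (g z)) \<le> M" if "z \<in> A" for z
    using f(2) assms(3) that by blast
  then show ?thesis
    unfolding lipschitz_bounded_def
    using lipschitz_on_compose2[OF assms(2) lipschitz_on_subset[OF f(1) assms(3)]] by blast
qed

lemma lipschitz_bounded_linear:
  assumes "bounded_linear h" "lipschitz_bounded A f"
  shows "lipschitz_bounded A (\<lambda>z. h (f z))"
proof -
  obtain L M where f: "L-lipschitz_on A f" "\<And>z. z \<in> A \<Longrightarrow> norm (f z) \<le> M"
    using assms(2) unfolding lipschitz_bounded_def by blast
  interpret h: bounded_linear h by fact
  obtain N where N: "0 \<le> N" "\<And>x. norm (h x) \<le> norm x * N" using h.nonneg_bounded by blast
  have "(N * L)-lipschitz_on A (\<lambda>z. h (f z))"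
  proof (rule lipschitz_onI)
    fix x y assume xy: "x \<in> A" "y \<in> A"
    have "dist (h (f x)) (h (f y)) \<le> dist (f x) (f y) * N"
      using N(2)[of "f x - f y"] by (simp add: dist_norm h.diff)
    also have "\<dots> \<le> (L * dist x y) * N"
      by (rule mult_right_mono[OF lipschitz_onD[OF f(1) xy] N(1)])
    finally show "dist (h (f x)) (h (f y)) \<le> N * L * dist x y" by (simp add: mult_ac)
  qed (use N lipschitz_on_nonneg[OF f(1)] in simp)
  moreover have "norm (h (f z)) \<le> M * N" if "z \<in> A" for z
    by (rule order_trans[OF N(2) mult_right_mono[OF f(2)[OF that] N(1)]])
  ultimately show ?thesis unfolding lipschitz_bounded_def by blast
qed

lemma lipschitz_bounded_nth:
  "lipschitz_bounded A f \<Longrightarrow> lipschitz_bounded A (\<lambda>z. f z $ i)"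
  by (rule lipschitz_bounded_linear[OF bounded_linear_vec_nth])

lemma lipschitz_bounded_diff:
  assumes "lipschitz_bounded A f" "lipschitz_bounded A g"
  shows "lipschitz_bounded A (\<lambda>z. f z - g z)"
  using lipschitz_bounded_add[OF assms(1)
      lipschitz_bounded_linear[OF bounded_linear_minus[OF bounded_linear_ident] assms(2)]] by simp

lemma lipschitz_bounded_Pair:
  assumes "lipschitz_bounded A f" "lipschitz_bounded A g"
  shows "lipschitz_bounded A (\<lambda>z. (f z, g z))"
proof -
  obtain L M L' M' where f: "L-lipschitz_on A f" "\<And>z. z \<in> A \<Longrightarrow> norm (f z) \<le> M"
    and g: "L'-lipschitz_on A g" "\<And>z. z \<in> A \<Longrightarrow> norm (g z) \<le> M'"
    using assms unfolding lipschitz_bounded_def by blast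
  have "norm (f z, g z) \<le> M + M'" if "z \<in> A" for z
    by (rule order_trans[OF norm_Pair_le add_mono[OF f(2)[OF that] g(2)[OF that]]])
  then show ?thesis
    unfolding lipschitz_bounded_def using lipschitz_on_Pair[OF f(1) g(1)] by blast
qed

lemma lipschitz_bounded_inverse:
  fixes f :: "'a::metric_space \<Rightarrow> real"
  assumes "c > 0" "\<And>z. z \<in> A \<Longrightarrow> c \<le> f z" "\<exists>L. L-lipschitz_on A f"
  shows "lipschitz_bounded A (\<lambda>z. 1 / f z)"
proof -
  obtain L where L: "L-lipschitz_on A f" using assms by blast
  have "(L / (c * c))-lipschitz_on A (\<lambda>z. 1 / f z)"
  proof (rule lipschitz_onI)
    fix x y assume xy: "x \<in> A" "y \<in> A"
    have pos: "c \<le> f x" "c \<le> f y" using assms(2) xy by auto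
    have "dist (1 / f x) (1 / f y) = dist (f x) (f y) / (f x * f y)"
      using pos assms(1) by (simp add: dist_real_def field_simps abs_minus_commute)
    also have "\<dots> \<le> (L * dist x y) / (c * c)"
      using pos assms(1) lipschitz_onD[OF L xy] order_trans[OF zero_le_dist lipschitz_onD[OF L xy]]
      by (intro frac_le mult_mono) auto
    finally show "dist (1 / f x) (1 / f y) \<le> L / (c * c) * dist x y" by simp
  qed (use lipschitz_on_nonneg[OF L] in simp)
  moreover have "\<bar>1 / f z\<bar> \<le> 1 / c" if "z \<in> A" for z
    using assms(1) assms(2)[OF that] by (simp add: frac_le)
  ultimately show ?thesis unfolding lipschitz_bounded_def real_norm_def by blast
qed

section \<open>The divergence of the drift\<close>

lemma continuous_on_cut:
  fixes f k :: "'a::t2_space \<Rightarrow> real"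
  assumes "open S" "continuous_on S f" "continuous_on UNIV k" "closed K" "K \<subseteq> S" "\<And>z. z \<notin> K \<Longrightarrow> k z = 0"
  shows "continuous_on UNIV (\<lambda>z. f z * k z)"
proof -
  have "continuous_on S (\<lambda>z. f z * k z)"
    by (intro continuous_intros assms continuous_on_subset[OF assms(3)]) auto
  moreover have "continuous_on (- K) (\<lambda>z. f z * k z)"
    by (rule continuous_on_eq[of _ "\<lambda>z. 0"]) (use assms in auto)
  ultimately have "continuous_on (S \<union> - K) (\<lambda>z. f z * k z)"
    using assms by (intro continuous_on_open_Un) auto
  moreover have "S \<union> - K = UNIV" using assms by auto
  ultimately show ?thesis by simp
qed

text \<open>Outside the support of \<open>k\<close> the product vanishes whatever \<open>f\<close> is there, so the factor \<open>f\<close> has to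
  be regular only on \<open>S\<close>.\<close>

lemma test_function_mult:
  fixes f k :: "'a::euclidean_space \<Rightarrow> real"
  assumes "open S" "test_function S k"
    and f: "\<And>z. z \<in> S \<Longrightarrow> (f has_derivative (\<lambda>h. G z \<bullet> h)) (at z)" and G: "continuous_on S G"
  shows "test_function S (\<lambda>z. f z * k z)"
    and "\<And>z. z \<in> S \<Longrightarrow> frechet_derivative (\<lambda>z. f z * k z) (at z) i
          = f z * frechet_derivative k (at z) i + (G z \<bullet> i) * k z"
proof -
  define K where "K = closure {z. k z \<noteq> 0}"
  have K: "compact K" "K \<subseteq> S" using assms(2) by (auto simp: test_function_def K_def)
  have k0: "k z = 0" if "z \<notin> K" for z
    using that closure_subset[of "{z. k z \<noteq> 0}"] by (auto simp: K_def)
  have openK: "open (- K)" using K(1) compact_imp_closed by blast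
  have kd: "(k has_derivative frechet_derivative k (at z)) (at z)" for z
    using assms(2) frechet_derivative_works by (auto simp: test_function_def)
  have zero: "(p has_derivative (\<lambda>h. 0)) (at z)" if "z \<notin> K" "\<And>w. w \<notin> K \<Longrightarrow> p w = 0" for p :: "'a \<Rightarrow> real" and z
    by (rule has_derivative_transform_within_open[OF has_derivative_const openK]) (use that in auto)
  have dk0: "frechet_derivative k (at z) = (\<lambda>h. 0)" if "z \<notin> K" for z
    using has_derivative_unique[OF kd zero[OF that k0]] by simp
  have D: "((\<lambda>z. f z * k z) has_derivative
      (\<lambda>h. f z * frechet_derivative k (at z) h + (G z \<bullet> h) * k z)) (at z)" for z
  proof (cases "z \<in> S")
    case True
    then show ?thesis by (rule has_derivative_mult[OF f kd])
  next
    case False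
    then have "z \<notin> K" using K by auto
    then show ?thesis using zero[of z "\<lambda>z. f z * k z"] k0 dk0 by simp
  qed
  have F: "frechet_derivative (\<lambda>z. f z * k z) (at z)
       = (\<lambda>h. f z * frechet_derivative k (at z) h + (G z \<bullet> h) * k z)" for z
    by (rule frechet_derivative_at[OF D, symmetric])
  then show "frechet_derivative (\<lambda>z. f z * k z) (at z) i
          = f z * frechet_derivative k (at z) i + (G z \<bullet> i) * k z" for z
    by simp
  have kcont: "continuous_on UNIV k"
    by (rule has_derivative_continuous_on[OF has_derivative_at_withinI[OF kd]])
  have fcont: "continuous_on S f"
    by (rule has_derivative_continuous_on[OF has_derivative_at_withinI[OF f]])
  have sub: "closure {z. f z * k z \<noteq> 0} \<subseteq> K"
    unfolding K_def by (rule closure_mono) auto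
  show "test_function S (\<lambda>z. f z * k z)"
    unfolding test_function_def F
  proof (intro conjI allI ballI)
    show "(\<lambda>z. f z * k z) differentiable at z" for z using D differentiable_def by blast
    show "continuous_on UNIV (\<lambda>z. f z * frechet_derivative k (at z) i + (G z \<bullet> i) * k z)" if "i \<in> Basis" for i
    proof (intro continuous_on_add)
      show "continuous_on UNIV (\<lambda>z. f z * frechet_derivative k (at z) i)"
        using assms(2) that
        by (intro continuous_on_cut[OF assms(1) fcont _ compact_imp_closed[OF K(1)] K(2)])
           (auto simp: test_function_def dk0)
      show "continuous_on UNIV (\<lambda>z. (G z \<bullet> i) * k z)"
        by (intro continuous_on_cut[OF assms(1) _ kcont compact_imp_closed[OF K(1)] K(2)] continuous_intros G k0)
    qed
    show "compact (closure {z. f z * k z \<noteq> 0})"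
      using bounded_subset[OF compact_imp_bounded[OF K(1)] sub] by (simp add: compact_eq_bounded_closed)
    show "closure {z. f z * k z \<noteq> 0} \<subseteq> S" using sub K by auto
  qed
qed

lemma test_function_mollifier_grad:
  fixes x k :: "'a::euclidean_space"
  assumes "cball x \<delta> \<subseteq> S" "\<delta> > 0"
  shows "test_function S (\<lambda>z. - (mollifier_grad \<delta> (x - z) \<bullet> k))"
    and "frechet_derivative (\<lambda>z. - (mollifier_grad \<delta> (x - z) \<bullet> k)) (at z) i = mollifier_hess \<delta> (x - z) i \<bullet> k"
proof -
  have D: "((\<lambda>z. - (mollifier_grad \<delta> (x - z) \<bullet> k)) has_derivative (\<lambda>h. mollifier_hess \<delta> (x - z) h \<bullet> k)) (at z)" for z
  proof -
    have "linear (mollifier_hess \<delta> (x - z))"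
      using has_derivative_mollifier_grad by (rule has_derivative_linear)
    note minus = linear_neg[OF this]
    have "((\<lambda>z. x - z) has_derivative (\<lambda>k. - k)) (at z)"
      by (auto intro!: derivative_eq_intros)
    from has_derivative_compose[OF this has_derivative_mollifier_grad[of \<delta> "x - z"]]
    have "((\<lambda>z. mollifier_grad \<delta> (x - z)) has_derivative (\<lambda>h. - mollifier_hess \<delta> (x - z) h)) (at z)"
      by (simp add: minus)
    from has_derivative_minus[OF has_derivative_inner_left[OF this, of k]]
    show ?thesis by simp
  qed
  have F: "frechet_derivative (\<lambda>z. - (mollifier_grad \<delta> (x - z) \<bullet> k)) (at z) = (\<lambda>h. mollifier_hess \<delta> (x - z) h \<bullet> k)" for z
    by (rule frechet_derivative_at[OF D, symmetric])
  then show "frechet_derivative (\<lambda>z. - (mollifier_grad \<delta> (x - z) \<bullet> k)) (at z) i = mollifier_hess \<delta> (x - z) i \<bullet> k"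
    by simp
  have sub: "closure {z. - (mollifier_grad \<delta> (x - z) \<bullet> k) \<noteq> 0} \<subseteq> cball x \<delta>"
  proof (rule closure_minimal[OF _ closed_cball], rule subsetI, rule ccontr)
    fix z assume "z \<in> {z. - (mollifier_grad \<delta> (x - z) \<bullet> k) \<noteq> 0}" "z \<notin> cball x \<delta>"
    then show False using mollifier_grad_eq_0[OF assms(2), of "x - z"] by (simp add: dist_norm)
  qed
  show "test_function S (\<lambda>z. - (mollifier_grad \<delta> (x - z) \<bullet> k))"
    unfolding test_function_def F
  proof (intro conjI allI ballI)
    show "(\<lambda>z. - (mollifier_grad \<delta> (x - z) \<bullet> k)) differentiable at z" for z using D differentiable_def by blast
    show "compact (closure {z. - (mollifier_grad \<delta> (x - z) \<bullet> k) \<noteq> 0})"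
      using bounded_subset[OF bounded_cball sub] by (simp add: compact_eq_bounded_closed)
  qed (use sub assms(1) in \<open>auto intro!: continuous_intros\<close>)
qed

text \<open>Both sides equal the integral of \<open>\<phi>\<close> against a mixed second derivative of the kernel.
  Hence a weak gradient is weakly curl free.\<close>

lemma weak_gradient_curl_free:
  fixes \<phi> :: "'a::euclidean_space \<Rightarrow> real"
  assumes "weak_deriv S i \<phi> (\<lambda>z. - u z)" "weak_deriv S j \<phi> (\<lambda>z. - v z)" "cball x \<delta> \<subseteq> S" "\<delta> > 0"
  shows "(LINT z:S|lborel. u z * (mollifier_grad \<delta> (x - z) \<bullet> j))
       = (LINT z:S|lborel. v z * (mollifier_grad \<delta> (x - z) \<bullet> i))"
proof -
  have *: "(LINT z:S|lborel. \<phi> z * (mollifier_hess \<delta> (x - z) i \<bullet> j))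
      = - (LINT z:S|lborel. u z * (mollifier_grad \<delta> (x - z) \<bullet> j))"
    if "weak_deriv S i \<phi> (\<lambda>z. - u z)" for i j u
    using that test_function_mollifier_grad[OF assms(3,4), of j]
    unfolding weak_deriv_def by (force simp: set_lebesgue_integral_def)
  show ?thesis
    using *[OF assms(1), of j] *[OF assms(2), of i] mollifier_hess_symmetric[of \<delta> _ i j]
    by simp
qed

lemma set_integrable_support:
  fixes f :: "'a::euclidean_space \<Rightarrow> real"
  assumes "continuous_on S f" "compact K" "K \<subseteq> S" "\<And>z. z \<notin> K \<Longrightarrow> f z = 0"
  shows "set_integrable lborel S f"
proof -
  have "integrable lborel (\<lambda>z. indicator K z *\<^sub>R f z)"
    by (intro borel_integrable_compact assms continuous_on_subset[OF assms(1)])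
  moreover have "(\<lambda>z. indicator K z *\<^sub>R f z) = (\<lambda>z. indicator S z *\<^sub>R f z)"
    using assms(3,4) by (auto simp: fun_eq_iff indicator_def)
  ultimately show ?thesis by (simp add: set_integrable_def)
qed

lemma eq_if_mollify_eq:
  assumes "open S" "continuous_on S u" "continuous_on S v" "x \<in> S"
    and "\<And>\<delta>. \<delta> > 0 \<Longrightarrow> cball x (2 * \<delta>) \<subseteq> S \<Longrightarrow> mollify S \<delta> u x = mollify S \<delta> v x"
  shows "u x = v x"
proof (rule tendsto_unique)
  show "((\<lambda>\<delta>. mollify S \<delta> u x) \<longlongrightarrow> v x) (at_right 0)"
    by (rule Lim_transform_eventually[OF tendsto_mollify[OF assms(1,3,4)]])
      (use eventually_inner_point[OF assms(1,4)] in \<open>eventually_elim, use assms(5) in auto\<close>)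
qed (use tendsto_mollify[OF assms(1,2,4)] in auto)

text \<open>Testing the divergence of \<open>rot (E / b)\<close> against \<open>b * k\<close> instead of \<open>k\<close> cancels the quotient. What
  remains of the derivatives of \<open>E\<close> is its weak curl, which vanishes; only the derivatives of \<open>b\<close>
  survive. Since both sides of the resulting identity are continuous, equality of their
  mollifications at all small radii gives equality at the point.\<close>

lemma divergence_rot_over_b:
  fixes E :: "real \<times> (real^3) \<Rightarrow> real^3" and b divF :: "real \<times> (real^3) \<Rightarrow> real"
    and G :: "real \<times> (real^3) \<Rightarrow> real \<times> (real^3)"
  defines "B \<equiv> \<lambda>z. b (fst z, perp (snd z))"
  assumes S: "open S"
    and E_grad: "\<And>i. weak_deriv S (0, axis i 1) \<phi> (\<lambda>z. - (E z $ i))"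
    and E: "continuous_on S E"
    and B_pos: "\<And>z. z \<in> S \<Longrightarrow> B z > 0"
    and B_deriv: "\<And>z. z \<in> S \<Longrightarrow> (B has_derivative (\<lambda>h. G z \<bullet> h)) (at z)"
    and G: "continuous_on S G"
    and divF: "weak_div_perp S (\<lambda>(t, x). rot (perp (F_field E b t x))) divF"
    and divF_cont: "continuous_on S divF"
    and z0: "z0 \<in> S"
  shows "divF z0 * (B z0)\<^sup>2 = E z0 $ 2 * snd (G z0) $ 1 - E z0 $ 1 * snd (G z0) $ 2"
proof -
  define w where "w z = (E z $ 2 * snd (G z) $ 1 - E z $ 1 * snd (G z) $ 2) / B z" for z
  have B: "continuous_on S B"
    by (rule has_derivative_continuous_on[OF has_derivative_at_withinI[OF B_deriv]])
  have w: "continuous_on S w"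
    unfolding w_def using B_pos by (intro continuous_intros E G B) force
  have "divF z0 * B z0 = w z0"
  proof (rule eq_if_mollify_eq[OF S _ w z0])
    show "continuous_on S (\<lambda>z. divF z * B z)" by (intro continuous_intros divF_cont B)
    fix \<delta> :: real assume \<delta>: "\<delta> > 0" "cball z0 (2 * \<delta>) \<subseteq> S"
    (* k is the kernel centred at z0 and d i its derivative in the i-th space direction. *)
    define K where "K = cball z0 \<delta>"
    have K: "compact K" "K \<subseteq> S" using \<delta> by (auto simp: K_def)
    define k where "k z = mollifier \<delta> (z0 - z)" for z
    define d where "d i z = - (mollifier_grad \<delta> (z0 - z) \<bullet> (0, axis i 1))" for i :: 3 and z
    have k0: "k z = 0" and d0: "d i z = 0" if "z \<notin> K" for z i
      using that \<delta> mollifier_eq_0[of \<delta> "z0 - z"] mollifier_grad_eq_0[of \<delta> "z0 - z"]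
      by (auto simp: k_def d_def K_def dist_norm)
    have kc: "continuous_on A k" and dc: "continuous_on A (d i)" for A i
      unfolding k_def d_def by (auto intro!: continuous_intros)
    have tk: "test_function S k" and dk: "frechet_derivative k (at z) (0, axis i 1) = d i z" for z i
      using test_function_mollifier[of z0 \<delta> S] K(2) \<delta>(1) unfolding k_def d_def K_def by auto
    have tBk: "test_function S (\<lambda>z. B z * k z)"
      and dBk: "z \<in> S \<Longrightarrow> frechet_derivative (\<lambda>z. B z * k z) (at z) (0, axis i 1)
             = B z * d i z + snd (G z) $ i * k z" for z i
      using test_function_mult[OF S tk B_deriv G] by (simp_all add: dk inner_Pair_0 inner_axis)
    have int: "set_integrable lborel S (\<lambda>z. f z * k z)" "set_integrable lborel S (\<lambda>z. f z * d i z)"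
      if "continuous_on S f" for f i
      using that by (auto intro!: set_integrable_support[OF _ K] continuous_intros kc dc simp: k0 d0)
    have E_int: "set_integrable lborel S (\<lambda>z. E z $ j * d i z)" for i j
      by (intro int continuous_intros E)
    have curl: "(LINT z:S|lborel. E z $ 1 * d 2 z) = (LINT z:S|lborel. E z $ 2 * d 1 z)"
      using weak_gradient_curl_free[OF E_grad[of 1] E_grad[of 2], of z0 \<delta>] K(2) \<delta>(1)
      by (simp add: d_def K_def set_lebesgue_integral_def)
    have "(LINT z:S|lborel. (E z $ 1 * d 2 z - E z $ 2 * d 1 z) - w z * k z)
       = (LINT z:S|lborel. rot (perp (F_field E b (fst z) (snd z))) $ 1 * frechet_derivative (\<lambda>z. B z * k z) (at z) (0, axis 1 1)
           + rot (perp (F_field E b (fst z) (snd z))) $ 2 * frechet_derivative (\<lambda>z. B z * k z) (at z) (0, axis 2 1))"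
    proof (rule set_lebesgue_integral_cong)
      show "S \<in> sets lborel" using S by simp
      show "\<forall>z. z \<in> S \<longrightarrow> (E z $ 1 * d 2 z - E z $ 2 * d 1 z) - w z * k z
        = rot (perp (F_field E b (fst z) (snd z))) $ 1 * frechet_derivative (\<lambda>z. B z * k z) (at z) (0, axis 1 1)
           + rot (perp (F_field E b (fst z) (snd z))) $ 2 * frechet_derivative (\<lambda>z. B z * k z) (at z) (0, axis 2 1)"
      proof (intro allI impI)
        fix z assume z: "z \<in> S"
        have F: "F_field E b (fst z) (snd z) = (1 / B z) *\<^sub>R E z"
          by (simp add: F_field_def B_def)
        have "B z \<noteq> 0" using B_pos[OF z] by simp
        then show "(E z $ 1 * d 2 z - E z $ 2 * d 1 z) - w z * k z
        = rot (perp (F_field E b (fst z) (snd z))) $ 1 * frechet_derivative (\<lambda>z. B z * k z) (at z) (0, axis 1 1)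
           + rot (perp (F_field E b (fst z) (snd z))) $ 2 * frechet_derivative (\<lambda>z. B z * k z) (at z) (0, axis 2 1)"
          unfolding dBk[OF z] F by (simp add: w_def field_simps)
      qed
    qed
    also have "\<dots> = - (LINT z:S|lborel. divF z * (B z * k z))"
      using divF tBk by (simp add: weak_div_perp_def case_prod_unfold)
    also have "(LINT z:S|lborel. (E z $ 1 * d 2 z - E z $ 2 * d 1 z) - w z * k z)
       = (LINT z:S|lborel. E z $ 1 * d 2 z) - (LINT z:S|lborel. E z $ 2 * d 1 z) - (LINT z:S|lborel. w z * k z)"
      by (simp add: set_integral_diff E_int int(1)[OF w])
    finally have "(LINT z:S|lborel. divF z * (B z * k z)) = (LINT z:S|lborel. w z * k z)"
      using curl by simp
    then show "mollify S \<delta> (\<lambda>z. divF z * B z) z0 = mollify S \<delta> w z0"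
      by (simp add: mollify_def k_def mult.assoc)
  qed
  then show ?thesis using B_pos[OF z0] by (simp add: w_def power2_eq_square field_simps)
qed

lemma grad_perp_slice:
  assumes "((\<lambda>y. b (t, perp y)) has_derivative (\<lambda>h. p \<bullet> h)) (at x)"
  shows "grad_perp (\<lambda>y. b (t, perp y)) x = perp p"
proof -
  have "frechet_derivative (\<lambda>y. b (t, perp y)) (at x) = (\<lambda>h. p \<bullet> h)"
    using frechet_derivative_at[OF assms] by simp
  then show ?thesis by (intro vec3_eqI) (simp_all add: grad_perp_def inner_axis)
qed

text \<open>A Taylor estimate on the closed strip restricts to each time slice. This includes the
  slices at the two end points, where the time variable has no room on one side.\<close>

lemma slice_has_derivative:
  fixes b :: "real \<times> (real^3) \<Rightarrow> real"
  assumes "t \<in> {0..T}"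
   "\<And>z w. z \<in> {0..T} \<times> UNIV \<Longrightarrow> w \<in> {0..T} \<times> UNIV \<Longrightarrow>
     \<bar>b (fst w, perp (snd w)) - b (fst z, perp (snd z)) - G z \<bullet> (w - z)\<bar> \<le> L * (norm (w - z))\<^sup>2"
  shows "((\<lambda>y. b (t, perp y)) has_derivative (\<lambda>h. snd (G (t, x)) \<bullet> h)) (at x)"
proof (rule quadratic_remainder_imp_has_derivative[where S = UNIV and L = L])
  fix y :: "real^3"
  show "\<bar>b (t, perp y) - b (t, perp x) - snd (G (t, x)) \<bullet> (y - x)\<bar> \<le> L * (norm (y - x))\<^sup>2"
    using assms(2)[of "(t, x)" "(t, y)"] assms(1) by (cases "G (t, x)") (simp add: norm_Pair)
qed auto

section \<open>Classical regularity of the electromagnetic field\<close>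

text \<open>The consequences of the Sobolev hypotheses on which the analysis of the schemes relies,
  all of them pointwise and valid up to the end points of the time interval.\<close>

locale regular_fields =
  fixes T b0 :: real and E :: "real \<times> (real^3) \<Rightarrow> real^3" and b divF chi :: "real \<times> (real^3) \<Rightarrow> real"
  assumes T_pos: "T > 0" and b0_pos: "b0 > 0"
    and E_regular: "lipschitz_bounded ({0..T} \<times> UNIV) E"
    and b_lipschitz: "\<exists>L. L-lipschitz_on ({0..T} \<times> UNIV) (\<lambda>z. b (fst z, perp (snd z)))"
    and b_lower: "\<And>t x. t \<in> {0..T} \<Longrightarrow> b0 \<le> b (t, perp x)"
    and b_differentiable: "\<And>t x. t \<in> {0..T} \<Longrightarrow> (\<lambda>y. b (t, perp y)) differentiable (at x)"
    and grad_b_regular: "lipschitz_bounded ({0..T} \<times> UNIV)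
          (\<lambda>z. grad_perp (\<lambda>y. b (fst z, perp y)) (snd z))"
    and divF_eq: "\<And>t x. t \<in> {0..T} \<Longrightarrow> divF (t, x) * (b (t, perp x))\<^sup>2 =
          E (t, x) $ 2 * grad_perp (\<lambda>y. b (t, perp y)) x $ 1
        - E (t, x) $ 1 * grad_perp (\<lambda>y. b (t, perp y)) x $ 2"
    and chi_lipschitz: "\<And>R. \<exists>L. L-lipschitz_on (cball 0 R) chi"
    and chi_zero: "\<And>e. e \<ge> 0 \<Longrightarrow> chi (e, 0) = e"
    and chi_bounds: "\<And>e v. 0 \<le> chi (e, perp v) \<and> chi (e, perp v) \<le> \<bar>e\<bar>"

lemma regular_fieldsI:
  fixes T b0 :: real
    and \<phi> b chi divF :: "real \<times> (real^3) \<Rightarrow> real"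
    and E :: "real \<times> (real^3) \<Rightarrow> real^3"
  assumes T: "T > 0"
    and E_grad: "\<And>i. weak_deriv (strip T) (0, axis i 1) \<phi> (\<lambda>z. - (E z $ i))"
    and E_W: "\<And>i. W_infty 1 (strip T) (\<lambda>z. E z $ i)"
    and E_cont: "continuous_on ({0..T} \<times> UNIV) E"
    and b0: "b0 > 0" "\<And>t x. t \<in> {0<..<T} \<Longrightarrow> b (t, perp x) > b0"
    and b_W: "W_infty 2 (strip T) (\<lambda>(t, x). b (t, perp x))"
    and b_cont: "continuous_on ({0..T} \<times> UNIV) (\<lambda>(t, x). b (t, perp x))"
    and chi_W: "W_infty_loc 1 UNIV chi"
    and chi_cont: "continuous_on UNIV chi"
    and chi_zero: "\<And>e. e \<ge> 0 \<Longrightarrow> chi (e, 0) = e"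
    and chi_bounds: "\<And>e v. 0 \<le> chi (e, perp v) \<and> chi (e, perp v) \<le> \<bar>e\<bar>"
    and divF: "weak_div_perp (strip T) (\<lambda>(t, x). rot (perp (F_field E b t x))) divF"
    and divF_cont: "continuous_on ({0..T} \<times> UNIV) divF"
  shows "regular_fields T b0 E b divF chi"
proof -
  note strip = strip_open_convex_closure[OF T]
  let ?C = "{0..T} \<times> (UNIV :: (real^3) set)"
  define B where "B z = b (fst z, perp (snd z))" for z
  have B_W: "W_infty (Suc (Suc 0)) (strip T) B" and B_cont: "continuous_on ?C B"
    using b_W b_cont by (simp_all add: B_def[abs_def] case_prod_unfold numeral_2_eq_2)
  have sub: "strip T \<subseteq> ?C" by auto
  obtain G L M where G: "L-lipschitz_on ?C G" "\<And>z. z \<in> ?C \<Longrightarrow> norm (G z) \<le> M"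
    and taylor: "\<And>z w. z \<in> ?C \<Longrightarrow> w \<in> ?C \<Longrightarrow> \<bar>B w - B z - G z \<bullet> (w - z)\<bar> \<le> L * (norm (w - z))\<^sup>2"
    using W_infty_2_imp_C11[OF strip(1,2) B_W] B_cont unfolding strip(3) by metis
  have slice: "((\<lambda>y. b (t, perp y)) has_derivative (\<lambda>h. snd (G (t, x)) \<bullet> h)) (at x)"
    if "t \<in> {0..T}" for t x
    using slice_has_derivative[OF that] taylor unfolding B_def by blast
  have grad: "grad_perp (\<lambda>y. b (t, perp y)) x = perp (snd (G (t, x)))" if "t \<in> {0..T}" for t x
    using slice[OF that] by (rule grad_perp_slice)
  have b_lower: "b0 \<le> B z" if "z \<in> ?C" for z
  proof -
    have "- B z \<le> - b0"
    proof (rule continuous_le_on_closure[where f = "\<lambda>z. - B z" and S = "strip T"])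
      show "continuous_on (closure (strip T)) (\<lambda>z. - B z)"
        unfolding strip(3) by (intro continuous_intros B_cont)
      show "- B z \<le> - b0" if "z \<in> strip T" for z
        using b0(2)[of "fst z" "snd z"] that by (auto simp: B_def)
    qed (use that in \<open>simp add: strip(3)\<close>)
    then show ?thesis by simp
  qed
  have G_cont: "continuous_on ?C G" using G(1) by (rule lipschitz_on_continuous_on)
  have div: "divF z * (B z)\<^sup>2 = E z $ 2 * snd (G z) $ 1 - E z $ 1 * snd (G z) $ 2" if "z \<in> ?C" for z
  proof -
    let ?f = "\<lambda>z. \<bar>divF z * (B z)\<^sup>2 - (E z $ 2 * snd (G z) $ 1 - E z $ 1 * snd (G z) $ 2)\<bar>"
    have "?f z \<le> 0"
    proof (rule continuous_le_on_closure[where f = ?f and S = "strip T"])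
      show "continuous_on (closure (strip T)) ?f"
        unfolding strip(3) by (intro continuous_intros B_cont divF_cont E_cont G_cont)
      fix z assume z: "z \<in> strip T"
      have "divF z * (b (fst z, perp (snd z)))\<^sup>2 = E z $ 2 * snd (G z) $ 1 - E z $ 1 * snd (G z) $ 2"
      proof (rule divergence_rot_over_b[OF strip(1) E_grad _ _ _ _ divF _ z])
        show "b (fst z, perp (snd z)) > 0" if "z \<in> strip T" for z
          using b_lower[of z] that sub b0(1) by (auto simp: B_def)
        show "((\<lambda>z. b (fst z, perp (snd z))) has_derivative (\<bullet>) (G z)) (at z)" if "z \<in> strip T" for z
          using taylor[of z] that sub unfolding B_def
          by (intro quadratic_remainder_imp_has_derivative[OF strip(1)]) auto
      qed (use sub E_cont G_cont divF_cont continuous_on_subset in blast)+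
      then show "?f z \<le> 0" by (simp add: B_def)
    qed (use that in \<open>simp add: strip(3)\<close>)
    then show ?thesis by simp
  qed
  have comp_cont: "continuous_on (closure (strip T)) (\<lambda>z. E z $ i)" for i
    unfolding strip(3) by (intro continuous_intros E_cont)
  have grad_z: "grad_perp (\<lambda>y. b (fst z, perp y)) (snd z) = perp (snd (G z))" if "z \<in> ?C" for z
    using grad[of "fst z" "snd z"] that by auto
  show ?thesis
  proof
    have "\<exists>L. L-lipschitz_on ?C E"
      using components_lipschitz[OF W_infty_imp_lipschitz[OF strip(1,2) E_W[unfolded One_nat_def] comp_cont]]
      unfolding strip(3) .
    moreover have "\<exists>M. \<forall>z\<in>?C. norm (E z) \<le> M"
      using L_infty_imp_bounded[OF strip(1) W_infty_imp_L_infty[OF E_W] comp_cont]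
      unfolding strip(3) by (intro components_bounded) auto
    ultimately show "lipschitz_bounded ?C E" by (simp add: lipschitz_bounded_def)
    show "\<exists>L. L-lipschitz_on ?C (\<lambda>z. b (fst z, perp (snd z)))"
      using W_infty_imp_lipschitz[OF strip(1,2) B_W] B_cont unfolding strip(3) B_def by auto
    show "b0 \<le> b (t, perp x)" if "t \<in> {0..T}" for t x
      using b_lower[of "(t, x)"] that by (simp add: B_def)
    show "(\<lambda>y. b (t, perp y)) differentiable at x" if "t \<in> {0..T}" for t x
      using slice[OF that] differentiable_def by blast
    have "\<exists>L. L-lipschitz_on ?C (\<lambda>z. grad_perp (\<lambda>y. b (fst z, perp y)) (snd z))"
    proof (intro exI[of _ L] lipschitz_onI)
      fix z w assume zw: "z \<in> ?C" "w \<in> ?C"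
      have "dist (perp (snd (G z))) (perp (snd (G w))) = norm (perp (snd (G z - G w)))"
        unfolding dist_norm by (rule arg_cong[where f = norm]) (intro vec3_eqI, simp_all)
      also have "\<dots> \<le> norm (G z - G w)"
        by (rule order_trans[OF norm_perp_le norm_snd_le_norm])
      also have "\<dots> \<le> L * dist z w"
        using lipschitz_onD[OF G(1) zw] by (simp add: dist_norm)
      finally show "dist (grad_perp (\<lambda>y. b (fst z, perp y)) (snd z)) (grad_perp (\<lambda>y. b (fst w, perp y)) (snd w))
           \<le> L * dist z w"
        using zw by (simp only: grad_z)
    qed (rule lipschitz_on_nonneg[OF G(1)])
    moreover have "\<exists>M. \<forall>z\<in>?C. norm (grad_perp (\<lambda>y. b (fst z, perp y)) (snd z)) \<le> M"
    proof (intro exI[of _ M] ballI)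
      fix z assume z: "z \<in> ?C"
      show "norm (grad_perp (\<lambda>y. b (fst z, perp y)) (snd z)) \<le> M"
        unfolding grad_z[OF z] by (rule order_trans[OF order_trans[OF norm_perp_le norm_snd_le_norm] G(2)[OF z]])
    qed
    ultimately show "lipschitz_bounded ?C (\<lambda>z. grad_perp (\<lambda>y. b (fst z, perp y)) (snd z))"
      by (simp add: lipschitz_bounded_def)
    show "divF (t, x) * (b (t, perp x))\<^sup>2 =
          E (t, x) $ 2 * grad_perp (\<lambda>y. b (t, perp y)) x $ 1
        - E (t, x) $ 1 * grad_perp (\<lambda>y. b (t, perp y)) x $ 2" if "t \<in> {0..T}" for t x
      using div[of "(t, x)"] that by (simp add: B_def grad)
    show "\<exists>L. L-lipschitz_on (cball 0 R) chi" for R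
    proof -
      let ?\<Omega> = "ball (0 :: real \<times> (real^3)) (\<bar>R\<bar> + 1)"
      have "W_infty (Suc 0) ?\<Omega> chi"
        using chi_W by (simp add: W_infty_loc_def compact_closure)
      then have "\<exists>L. L-lipschitz_on (closure ?\<Omega>) chi"
        by (rule W_infty_imp_lipschitz[OF open_ball convex_ball _ continuous_on_subset[OF chi_cont subset_UNIV]])
      moreover have "cball 0 R \<subseteq> closure ?\<Omega>" by auto
      ultimately show ?thesis using lipschitz_on_subset by blast
    qed
  qed (use assms in auto)
qed

section \<open>Two estimates for differential equations\<close>

lemma increment_bound:
  fixes g :: "real \<Rightarrow> 'a::real_normed_vector"
  assumes "\<And>s. s \<in> {a..b} \<Longrightarrow> (g has_vector_derivative g' s) (at s within {a..b})"
    and "\<And>s. s \<in> {a..b} \<Longrightarrow> norm (g' s) \<le> M" "s \<in> {a..b}"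
  shows "norm (g s - g a) \<le> M * (s - a)"
proof -
  have "norm (g s - g a) \<le> M * norm (s - a)"
  proof (rule differentiable_bound[of "{a..b}" g "\<lambda>s h. h *\<^sub>R g' s"])
    fix u assume u: "u \<in> {a..b}"
    show "(g has_derivative (\<lambda>h. h *\<^sub>R g' u)) (at u within {a..b})"
      using assms(1)[OF u] by (simp add: has_vector_derivative_def)
    show "onorm (\<lambda>h. h *\<^sub>R g' u) \<le> M"
      using mult_right_mono[OF assms(2)[OF u] abs_ge_zero] by (intro onorm_le) (simp add: mult.commute)
  qed (use assms(3) in auto)
  then show ?thesis using assms(3) by simp
qed

text \<open>Gronwall's inequality in the form that \<open>(e s)\<^sup>2 * exp (- 2 * M * s)\<close> does not increase.\<close>

lemma linear_ode_bound:
  fixes e k :: "real \<Rightarrow> real"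
  assumes e: "\<And>s. s \<in> {a..b} \<Longrightarrow> (e has_vector_derivative k s * e s) (at s within {a..b})"
    and k: "\<And>s. s \<in> {a..b} \<Longrightarrow> \<bar>k s\<bar> \<le> M" and s: "s \<in> {a..b}"
  shows "\<bar>e s\<bar> \<le> \<bar>e a\<bar> * exp (M * (s - a))"
proof -
  define w where "w r = (e r)\<^sup>2 * exp (- (2 * M * r))" for r
  have cont: "continuous_on {a..b} e"
    by (rule continuous_on_vector_derivative[OF e])
  have "w s \<le> w a"
  proof (rule DERIV_nonpos_imp_decreasing_open[where f = w and a = a and b = s])
    show "a \<le> s" using s by simp
    show "continuous_on {a..s} w"
      unfolding w_def using s by (intro continuous_intros continuous_on_subset[OF cont]) auto
    fix r assume r: "a < r" "r < s"
    then have rab: "r \<in> {a..b}" "r \<in> {a<..<b}" using s by auto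
    have "(e has_vector_derivative k r * e r) (at r within {a<..<b})"
      by (rule has_vector_derivative_within_subset[OF e[OF rab(1)]]) auto
    then have D: "(e has_real_derivative k r * e r) (at r)"
      using rab(2) by (simp add: has_real_derivative_iff_has_vector_derivative at_within_open[OF _ open_greaterThanLessThan])
    have "(w has_real_derivative 2 * (k r - M) * (e r)\<^sup>2 * exp (- (2 * M * r))) (at r)"
      unfolding w_def by (rule derivative_eq_intros D refl | simp)+ (simp add: algebra_simps power2_eq_square)
    moreover have "2 * (k r - M) * (e r)\<^sup>2 * exp (- (2 * M * r)) \<le> 0"
      using k[OF rab(1)] by (intro mult_nonpos_nonneg[OF mult_nonpos_nonneg]) auto
    ultimately show "\<exists>y. (w has_real_derivative y) (at r) \<and> y \<le> 0" by blast
  qed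
  then have "w s * exp (2 * M * s) \<le> w a * exp (2 * M * s)"
    by (intro mult_right_mono) auto
  then have "(e s)\<^sup>2 \<le> (e a)\<^sup>2 * (exp (M * (s - a)))\<^sup>2"
    by (simp add: w_def mult.assoc exp_add[symmetric] exp_double[symmetric] algebra_simps)
  then have "\<bar>e s\<bar>\<^sup>2 \<le> (\<bar>e a\<bar> * exp (M * (s - a)))\<^sup>2" by (simp add: power_mult_distrib)
  then show ?thesis by (rule power2_le_imp_le) simp
qed

section \<open>The semi-implicit scheme is uniformly bounded\<close>

context regular_fields
begin

abbreviation grad_b :: "real \<Rightarrow> real^3 \<Rightarrow> real^3" where
  "grad_b t x \<equiv> grad_perp (\<lambda>y. b (t, perp y)) x"

lemma field_bound:
  obtains K where "K > 0" "\<And>t x. t \<in> {0..T} \<Longrightarrow> norm (E (t, x)) \<le> K"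
    "\<And>t x. t \<in> {0..T} \<Longrightarrow> norm (grad_b t x) \<le> K"
proof -
  obtain M1 where M1: "\<And>z. z \<in> {0..T} \<times> UNIV \<Longrightarrow> norm (E z) \<le> M1"
    using E_regular unfolding lipschitz_bounded_def by blast
  obtain M2 where M2: "\<And>z. z \<in> {0..T} \<times> UNIV \<Longrightarrow> norm (grad_b (fst z) (snd z)) \<le> M2"
    using grad_b_regular unfolding lipschitz_bounded_def by blast
  show ?thesis
  proof (rule that[of "\<bar>M1\<bar> + \<bar>M2\<bar> + 1"])
    fix t x assume "t \<in> {0..T}"
    then show "norm (E (t, x)) \<le> \<bar>M1\<bar> + \<bar>M2\<bar> + 1" "norm (grad_b t x) \<le> \<bar>M1\<bar> + \<bar>M2\<bar> + 1"
      using M1[of "(t, x)"] M2[of "(t, x)"] by auto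
  qed simp
qed

lemma grad_perp_ln_b:
  assumes t: "t \<in> {0..T}"
  shows "grad_perp (\<lambda>y. ln (b (t, perp y))) x = (1 / b (t, perp x)) *\<^sub>R grad_b t x"
proof -
  have pos: "b (t, perp x) > 0" using b_lower[OF t, of x] b0_pos by linarith
  have D: "((\<lambda>y. b (t, perp y)) has_derivative frechet_derivative (\<lambda>y. b (t, perp y)) (at x)) (at x)"
    using b_differentiable[OF t] frechet_derivative_works by blast
  have "((\<lambda>y. ln (b (t, perp y))) has_derivative
      (\<lambda>h. frechet_derivative (\<lambda>y. b (t, perp y)) (at x) h * inverse (b (t, perp x)))) (at x)"
    using DERIV_compose_FDERIV[OF DERIV_ln[OF pos] D] by simp
  from frechet_derivative_at[OF this, symmetric] show ?thesis
    by (intro vec3_eqI) (simp_all add: grad_perp_def field_simps)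
qed

lemma norm_H_field_le:
  assumes t: "t \<in> {0..T}" and K: "norm (E (t, x)) \<le> K" "norm (grad_b t x) \<le> K"
  shows "norm (H_field E b chi t x (perp v) e) \<le> K + K / b0 * \<bar>e\<bar>"
proof -
  have pos: "b0 \<le> b (t, perp x)" using b_lower[OF t] .
  have "norm (H_field E b chi t x (perp v) e)
      \<le> norm (E (t, x)) + norm (chi (e, perp v) *\<^sub>R ((1 / b (t, perp x)) *\<^sub>R grad_b t x))"
    unfolding H_field_def grad_perp_ln_b[OF t] by (rule norm_triangle_ineq4)
  also have "norm (chi (e, perp v) *\<^sub>R ((1 / b (t, perp x)) *\<^sub>R grad_b t x))
      = \<bar>chi (e, perp v)\<bar> * (norm (grad_b t x) / b (t, perp x))"
    using pos b0_pos by simp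
  also have "\<dots> \<le> \<bar>e\<bar> * (K / b0)"
    using chi_bounds[of e v] pos b0_pos K order_trans[OF norm_ge_zero K(2)] by (intro mult_mono frac_le) auto
  finally show ?thesis using K(1) by (simp add: mult.commute)
qed

lemma step_time:
  assumes "0 < dt" "n \<le> num_steps T dt"
  shows "real n * dt \<le> T" "real n * dt \<in> {0..T}"
proof -
  have "real n \<le> T / dt"
    using assms T_pos unfolding num_steps_def by (metis divide_pos_pos le_nat_floor less_imp_le nat_floor_neg of_nat_floor of_nat_le_iff order_trans)
  then show "real n * dt \<le> T" using assms by (simp add: field_simps)
  then show "real n * dt \<in> {0..T}" using assms by simp
qed

text \<open>In the third equation the implicit part is collected on the left, as \<open>v + c * rot (perp v)\<close>
  with \<open>v\<close> the new velocity, so that the orthogonality of the rotation can be used.\<close>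

lemma schemeD:
  assumes "semi_implicit_scheme E b chi T \<epsilon> dt x v e" "n + 1 \<le> num_steps T dt" "dt > 0"
  shows "x (n + 1) = x n + dt *\<^sub>R v (n + 1)"
    and "e (n + 1) = e n + dt * (perp (E (real n * dt, x n)) \<bullet> perp (v (n + 1)))"
    and "v (n + 1) + (dt * b (real n * dt, perp (x n)) / \<epsilon>) *\<^sub>R rot (perp (v (n + 1)))
       = v n + dt *\<^sub>R H_field E b chi (real n * dt) (x n) (perp (v n)) (e n)"
proof -
  let ?t = "real n * dt"
  have s: "(1 / dt) *\<^sub>R (x (n + 1) - x n) = v (n + 1)"
    "(e (n + 1) - e n) / dt = perp (E (?t, x n)) \<bullet> perp (v (n + 1))"
    "(1 / dt) *\<^sub>R (v (n + 1) - v n) = H_field E b chi ?t (x n) (perp (v n)) (e n)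
            - b (?t, perp (x n)) *\<^sub>R ((1 / \<epsilon>) *\<^sub>R rot (perp (v (n + 1))))"
    using assms(1,2) unfolding semi_implicit_scheme_def Let_def by blast+
  have "dt *\<^sub>R ((1 / dt) *\<^sub>R (x (n + 1) - x n)) = dt *\<^sub>R v (n + 1)" by (simp only: s)
  then show "x (n + 1) = x n + dt *\<^sub>R v (n + 1)" using assms(3) by (simp add: algebra_simps)
  show "e (n + 1) = e n + dt * (perp (E (?t, x n)) \<bullet> perp (v (n + 1)))"
    unfolding s(2)[symmetric] using assms(3) by simp
  have "dt *\<^sub>R ((1 / dt) *\<^sub>R (v (n + 1) - v n)) = dt *\<^sub>R (H_field E b chi ?t (x n) (perp (v n)) (e n)
            - b (?t, perp (x n)) *\<^sub>R ((1 / \<epsilon>) *\<^sub>R rot (perp (v (n + 1)))))" by (simp only: s)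
  then show "v (n + 1) + (dt * b (?t, perp (x n)) / \<epsilon>) *\<^sub>R rot (perp (v (n + 1)))
       = v n + dt *\<^sub>R H_field E b chi ?t (x n) (perp (v n)) (e n)"
    using assms(3) by (simp add: algebra_simps)
qed

text \<open>A discrete Gronwall argument for \<open>norm v + \<bar>e\<bar>\<close>. The magnetic term, the only one that
  contains \<open>\<epsilon>\<close>, disappears from the estimate of \<open>norm v\<close>; all other forces grow at most linearly.
  The positions are then controlled by summing the velocities.\<close>

lemma uniform_bound:
  "\<exists>C. \<forall>dt \<epsilon> x v e. 0 < dt \<and> dt \<le> T \<and> 0 < \<epsilon> \<and> semi_implicit_scheme E b chi T \<epsilon> dt x v e \<and>
            e 0 \<ge> 0 \<and> norm (x 0) + norm (v 0) + \<bar>e 0\<bar> \<le> R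
            \<longrightarrow> (\<forall>n\<le>num_steps T dt. norm (x n) + norm (v n) + \<bar>e n\<bar> \<le> C)"
proof -
  obtain K where K: "K > 0" "\<And>t x. t \<in> {0..T} \<Longrightarrow> norm (E (t, x)) \<le> K"
    "\<And>t x. t \<in> {0..T} \<Longrightarrow> norm (grad_b t x) \<le> K"
    using field_bound by blast
  (* Growth rate of norm v + |e| + 1. The factor 1 + K * T appears because the energy is
     advanced with the new velocity. *)
  define c where "c = (1 + K * T) * (K + K / b0) + K"
  have c: "c \<ge> 0" using K T_pos b0_pos by (simp add: c_def)
  define A where "A = exp (c * T) * (R + 1)"
  show ?thesis
  proof (intro exI[of _ "R + T * A + A"] allI impI; elim conjE)
    fix dt \<epsilon> x v e n
    assume dt: "0 < dt" "dt \<le> T" and s: "semi_implicit_scheme E b chi T \<epsilon> dt x v e"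
      and R: "norm (x 0) + norm (v 0) + \<bar>e 0\<bar> \<le> R" and n: "n \<le> num_steps T dt"
    define a where "a n = norm (v n) + \<bar>e n\<bar> + 1" for n
    have R1: "a 0 \<le> R + 1" using R norm_ge_zero[of "x 0"] unfolding a_def by linarith
    have step: "a (n + 1) \<le> (1 + c * dt) * a n" if n: "n + 1 \<le> num_steps T dt" for n
    proof -
      let ?t = "real n * dt"
      have t: "?t \<in> {0..T}" using step_time[of dt n] n dt by simp
      note s = schemeD[OF s n dt(1)]
      have v: "norm (v (n + 1)) \<le> norm (v n) + dt * (K + K / b0 * \<bar>e n\<bar>)"
      proof -
        have "norm (v (n + 1)) \<le> norm (v n + dt *\<^sub>R H_field E b chi ?t (x n) (perp (v n)) (e n))"
          unfolding s(3)[symmetric] by (rule norm_le_norm_add_rot)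
        also have "\<dots> \<le> norm (v n) + dt * norm (H_field E b chi ?t (x n) (perp (v n)) (e n))"
          by (rule order_trans[OF norm_triangle_ineq]) (use dt in simp)
        finally show ?thesis
          using mult_left_mono[OF norm_H_field_le[OF t K(2,3)[OF t], of "x n" "v n" "e n"], of dt] dt by linarith
      qed
      have "\<bar>perp (E (?t, x n)) \<bullet> perp (v (n + 1))\<bar> \<le> K * norm (v (n + 1))"
        by (rule order_trans[OF Cauchy_Schwarz_ineq2 mult_mono])
          (use K(1) K(2)[OF t] in \<open>auto intro: order_trans[OF norm_perp_le]\<close>)
      then have e: "\<bar>e (n + 1)\<bar> \<le> \<bar>e n\<bar> + dt * (K * norm (v (n + 1)))"
        unfolding s(2) using dt mult_left_mono[of _ _ dt]
        by (intro order_trans[OF abs_triangle_ineq]) (auto simp: abs_mult)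
      have "a (n + 1) \<le> (1 + dt * K) * norm (v (n + 1)) + \<bar>e n\<bar> + 1"
        using e by (simp add: a_def algebra_simps)
      also have "(1 + dt * K) * norm (v (n + 1)) \<le> (1 + dt * K) * (norm (v n) + dt * (K + K / b0 * \<bar>e n\<bar>))"
        using v dt K by (intro mult_left_mono) auto
      also have "(1 + dt * K) * (norm (v n) + dt * (K + K / b0 * \<bar>e n\<bar>))
          = norm (v n) + dt * (K * norm (v n)) + dt * ((1 + dt * K) * (K + K / b0 * \<bar>e n\<bar>))"
        by (simp add: algebra_simps)
      also have "(1 + dt * K) * (K + K / b0 * \<bar>e n\<bar>) \<le> (1 + K * T) * ((K + K / b0) * a n)"
      proof (rule mult_mono)
        show "1 + dt * K \<le> 1 + K * T" using dt K by (simp add: mult.commute)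
        have "K + K / b0 * \<bar>e n\<bar> \<le> K * a n + K / b0 * a n"
          using K(1) b0_pos by (intro add_mono mult_left_mono) (auto simp: a_def)
        then show "K + K / b0 * \<bar>e n\<bar> \<le> (K + K / b0) * a n" by (simp add: distrib_right)
      qed (use K T_pos b0_pos in auto)
      also have "K * norm (v n) \<le> K * a n" using K(1) by (simp add: a_def)
      finally have "a (n + 1) \<le> norm (v n) + dt * (K * a n) + dt * ((1 + K * T) * ((K + K / b0) * a n)) + \<bar>e n\<bar> + 1"
        using dt by simp
      moreover have "norm (v n) + \<bar>e n\<bar> + 1 = a n" by (simp add: a_def)
      ultimately have "a (n + 1) \<le> a n + dt * (K * a n) + dt * ((1 + K * T) * ((K + K / b0) * a n))"
        by linarith
      then show ?thesis by (simp add: c_def algebra_simps add_divide_distrib)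
    qed
    have a: "a n \<le> A" if "n \<le> num_steps T dt" for n
    proof -
      have "a n \<le> (1 + c * dt) ^ n * (R + 1)"
        using that
      proof (induction n)
        case (Suc n)
        have "a (Suc n) \<le> (1 + c * dt) * a n" using step[of n] Suc.prems by simp
        also have "\<dots> \<le> (1 + c * dt) * ((1 + c * dt) ^ n * (R + 1))"
          using Suc dt c by (intro mult_left_mono) auto
        finally show ?case by (simp add: mult.assoc)
      qed (use R1 in simp)
      also have "\<dots> \<le> exp (c * dt) ^ n * (R + 1)"
        using c dt R1 by (intro mult_right_mono power_mono) (auto simp: a_def intro: order_trans[of _ "a 0"])
      also have "\<dots> = exp (c * (real n * dt)) * (R + 1)"
        by (simp add: exp_of_nat_mult[symmetric] mult_ac)
      also have "\<dots> \<le> A"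
        unfolding A_def using step_time(1)[OF dt(1) that] c R1
        by (intro mult_right_mono) (auto simp: a_def mult_left_mono intro: order_trans[of _ "a 0"])
      finally show ?thesis .
    qed
    have "0 \<le> a 0" by (simp add: a_def)
    then have A: "A \<ge> 0" using a[OF le0] by linarith
    have "norm (x n) \<le> R + real n * dt * A" if "n \<le> num_steps T dt" for n
      using that
    proof (induction n)
      case 0
      have "norm (x 0) \<le> R" using R norm_ge_zero[of "v 0"] abs_ge_zero[of "e 0"] by linarith
      then show ?case by simp
    next
      case (Suc n)
      have "norm (x (Suc n)) \<le> norm (x n) + dt * norm (v (Suc n))"
        using schemeD(1)[OF s _ dt(1), of n] Suc.prems dt norm_triangle_ineq[of "x n" "dt *\<^sub>R v (Suc n)"] by simp
      also have "\<dots> \<le> (R + real n * dt * A) + dt * A"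
        using Suc a[OF Suc.prems] dt by (intro add_mono mult_left_mono) (auto simp: a_def)
      finally show ?case by (simp add: algebra_simps)
    qed
    moreover have "real n * dt * A \<le> T * A"
      using step_time(1)[OF dt(1) n] A by (rule mult_right_mono)
    ultimately show "norm (x n) + norm (v n) + \<bar>e n\<bar> \<le> R + T * A + A"
      using a[OF n] n by (force simp: a_def)
  qed
qed


section \<open>Consistency with the guiding centre scheme\<close>

text \<open>The velocity equation solved for the perpendicular part of the new velocity, by applying
  the rotation once more. The right-hand side carries a factor \<open>\<epsilon>\<close> and is otherwise bounded,
  so the perpendicular velocity is of order \<open>\<epsilon>\<close> after the first step.\<close>

lemma fast_velocity:
  assumes "semi_implicit_scheme E b chi T \<epsilon> dt x v e" "n + 1 \<le> num_steps T dt" "dt > 0" "\<epsilon> > 0"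
  defines "t \<equiv> real n * dt"
  shows "perp (v (n + 1)) = - (\<epsilon> / b (t, perp (x n))) *\<^sub>R
     rot (H_field E b chi t (x n) (perp (v n)) (e n) - (1 / dt) *\<^sub>R (v (n + 1) - v n))"
proof -
  let ?b = "b (t, perp (x n))" and ?H = "H_field E b chi t (x n) (perp (v n)) (e n)"
  have "t \<in> {0..T}" using step_time[of dt n] assms by simp
  then have b: "?b > 0" using b_lower[of t "x n"] b0_pos by linarith
  have "(1 / dt) *\<^sub>R (v (n + 1) + (dt * ?b / \<epsilon>) *\<^sub>R rot (perp (v (n + 1)))) = (1 / dt) *\<^sub>R (v n + dt *\<^sub>R ?H)"
    using schemeD(3)[OF assms(1-3)] by (simp only: t_def)
  then have "?H - (1 / dt) *\<^sub>R (v (n + 1) - v n) = (?b / \<epsilon>) *\<^sub>R rot (perp (v (n + 1)))"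
    using assms(3) by (simp add: algebra_simps)
  then have "rot (?H - (1 / dt) *\<^sub>R (v (n + 1) - v n)) = (?b / \<epsilon>) *\<^sub>R rot (rot (v (n + 1)))"
    by (simp add: rot_perp linear_cmul[OF bounded_linear.linear[OF bounded_linear_rot]])
  then show ?thesis
    using b assms(4) by (simp add: rot_rot)
qed

lemma U_gc_alt:
  assumes "t \<in> {0..T}"
  shows "U_gc \<epsilon> E b t x e p = p *\<^sub>R e_z
     - (\<epsilon> / b (t, perp x)) *\<^sub>R rot (E (t, x) - (e / b (t, perp x)) *\<^sub>R grad_b t x)"
proof -
  have b: "b (t, perp x) > 0" using b_lower[OF assms, of x] b0_pos by linarith
  show ?thesis
    using b by (intro vec3_eqI) (simp_all add: U_gc_def F_field_def power2_eq_square field_simps)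
qed

text \<open>The new velocity is the guiding centre velocity plus \<open>\<epsilon>\<close> times two contributions. One is
  proportional to \<open>e - chi (e, perp v)\<close>, which is small when the perpendicular velocity is small
  and the energy is not far below zero; the other is the discrete derivative of the
  perpendicular velocity.\<close>

lemma velocity_defect:
  assumes "semi_implicit_scheme E b chi T \<epsilon> dt x v e" "n + 1 \<le> num_steps T dt" "dt > 0" "\<epsilon> > 0"
  defines "t \<equiv> real n * dt"
  defines "\<beta> \<equiv> b (t, perp (x n))"
  shows "v (n + 1) - U_gc \<epsilon> E b t (x n) (e n) (v (n + 1) $ 3)
     = - (\<epsilon> / \<beta>) *\<^sub>R rot (((e n - chi (e n, perp (v n))) / \<beta>) *\<^sub>R grad_b t (x n)
           - (1 / dt) *\<^sub>R (perp (v (n + 1)) - perp (v n)))"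
proof -
  have t: "t \<in> {0..T}" using step_time[of dt n] assms by simp
  note fv = fast_velocity[OF assms(1-4), folded t_def, folded \<beta>_def]
  have "v (n + 1) - U_gc \<epsilon> E b t (x n) (e n) (v (n + 1) $ 3)
     = perp (v (n + 1)) + (\<epsilon> / \<beta>) *\<^sub>R rot (E (t, x n) - (e n / \<beta>) *\<^sub>R grad_b t (x n))"
    by (intro vec3_eqI) (simp_all add: U_gc_alt[OF t] \<beta>_def)
  also have "\<dots> = - (\<epsilon> / \<beta>) *\<^sub>R rot (H_field E b chi t (x n) (perp (v n)) (e n) - (1 / dt) *\<^sub>R (v (n + 1) - v n))
      + (\<epsilon> / \<beta>) *\<^sub>R rot (E (t, x n) - (e n / \<beta>) *\<^sub>R grad_b t (x n))"
    by (simp only: fv)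
  also have "\<dots> = - (\<epsilon> / \<beta>) *\<^sub>R rot (((e n - chi (e n, perp (v n))) / \<beta>) *\<^sub>R grad_b t (x n)
           - (1 / dt) *\<^sub>R (perp (v (n + 1)) - perp (v n)))"
    unfolding H_field_def grad_perp_ln_b[OF t]
    by (intro vec3_eqI) (simp_all add: \<beta>_def[symmetric] algebra_simps add_divide_distrib diff_divide_distrib)
  finally show ?thesis .
qed

text \<open>The work of \<open>E\<close> along the drift velocity is the divergence term of the energy
  equation: the part of the drift generated by \<open>E\<close> itself is orthogonal to \<open>E\<close>, and the part
  generated by the gradient of \<open>b\<close> gives the divergence formula. So the energy
  residual is the work of \<open>E\<close> along the velocity residual.\<close>

lemma energy_defect:
  assumes "semi_implicit_scheme E b chi T \<epsilon> dt x v e" "n + 1 \<le> num_steps T dt" "dt > 0" "\<epsilon> > 0"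
  defines "t \<equiv> real n * dt"
  shows "(e (n + 1) - e n) / dt - \<epsilon> * e n * divF (t, x n)
     = perp (E (t, x n)) \<bullet> (v (n + 1) - U_gc \<epsilon> E b t (x n) (e n) (v (n + 1) $ 3))"
proof -
  have t: "t \<in> {0..T}" using step_time[of dt n] assms by simp
  have b: "b (t, perp (x n)) > 0" using b_lower[OF t, of "x n"] b0_pos by linarith
  have D: "divF (t, x n) = (E (t, x n) $ 2 * grad_b t (x n) $ 1 - E (t, x n) $ 1 * grad_b t (x n) $ 2) / (b (t, perp (x n)))\<^sup>2"
    using divF_eq[OF t, of "x n"] b by (simp add: field_simps)
  have "(e (n + 1) - e n) / dt = perp (E (t, x n)) \<bullet> v (n + 1)"
    using schemeD(2)[OF assms(1-3)] assms(3) by (simp add: t_def inner_vec3)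
  then show ?thesis
    unfolding D using b by (simp add: U_gc_alt[OF t] inner_vec3 power2_eq_square field_simps)
qed

lemma parallel_defect:
  assumes "semi_implicit_scheme E b chi T \<epsilon> dt x v e" "n + 1 \<le> num_steps T dt" "dt > 0"
  shows "(v (n + 1) $ 3 - v n $ 3) / dt = E (real n * dt, x n) $ 3"
proof -
  have t: "real n * dt \<in> {0..T}" using step_time[of dt n] assms by simp
  have "(v (n + 1) + (dt * b (real n * dt, perp (x n)) / \<epsilon>) *\<^sub>R rot (perp (v (n + 1)))) $ 3
      = (v n + dt *\<^sub>R H_field E b chi (real n * dt) (x n) (perp (v n)) (e n)) $ 3"
    by (simp only: schemeD(3)[OF assms])
  then show ?thesis using assms(3) by (simp add: H_field_def)
qed

text \<open>The perpendicular velocities at two consecutive levels must both be of order \<open>\<epsilon>\<close>, which is why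
  the estimate starts at \<open>n = 1\<close>. Then each energy increment is of order \<open>\<epsilon>\<close>, so an energy that
  is initially nonnegative stays above \<open>- C * \<epsilon>\<close>. This lower bound makes \<open>chi (e, 0)\<close> equal to \<open>e\<close>
  up to order \<open>\<epsilon>\<close> even when \<open>e\<close> has become negative. The constants \<open>C2\<close> and \<open>C3\<close> bound the
  perpendicular velocity divided by \<open>\<epsilon>\<close> and the velocity residual divided by \<open>\<epsilon>\<^sup>2\<close>.\<close>

lemma second_order_consistent:
  assumes dt: "0 < dt" "dt \<le> T"
  shows "\<exists>C. \<forall>\<epsilon> x v e. 0 < \<epsilon> \<and> semi_implicit_scheme E b chi T \<epsilon> dt x v e \<and>
            e 0 \<ge> 0 \<and> norm (x 0) + norm (v 0) + \<bar>e 0\<bar> \<le> R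
            \<longrightarrow> (\<forall>n\<ge>1. n + 1 \<le> num_steps T dt \<longrightarrow>
                  norm (gc_residual \<epsilon> E b divF dt (real n * dt)
                         (x n, e n, v n $ 3) (x (n + 1), e (n + 1), v (n + 1) $ 3))
                    \<le> C * \<epsilon>\<^sup>2)"
proof -
  obtain K where K: "K > 0" "\<And>t x. t \<in> {0..T} \<Longrightarrow> norm (E (t, x)) \<le> K"
    "\<And>t x. t \<in> {0..T} \<Longrightarrow> norm (grad_b t x) \<le> K"
    using field_bound by blast
  obtain C1 where C1: "\<And>\<epsilon> x v e n. 0 < \<epsilon> \<Longrightarrow> semi_implicit_scheme E b chi T \<epsilon> dt x v e \<Longrightarrow>
      e 0 \<ge> 0 \<Longrightarrow> norm (x 0) + norm (v 0) + \<bar>e 0\<bar> \<le> R \<Longrightarrow> n \<le> num_steps T dt \<Longrightarrow>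
      norm (x n) + norm (v n) + \<bar>e n\<bar> \<le> C1"
    using uniform_bound[of R] dt by blast
  obtain L where L: "L-lipschitz_on (cball 0 C1) chi" using chi_lipschitz by blast
  have L0: "L \<ge> 0" using L by (rule lipschitz_on_nonneg)
  define C2 where "C2 = (K + K / b0 * \<bar>C1\<bar> + 2 * \<bar>C1\<bar> / dt) / b0"
  have C2: "C2 \<ge> 0" using K b0_pos dt by (simp add: C2_def)
  define C3 where "C3 = ((2 * T * K * C2 + L * C2) * K / b0 + 2 * C2 / dt) / b0"
  have C3: "C3 \<ge> 0" using K b0_pos dt T_pos C2 L0 by (simp add: C3_def)
  show ?thesis
  proof (intro exI[of _ "C3 + K * C3"] allI impI; elim conjE)
    fix \<epsilon> x v e and n :: nat
    assume \<epsilon>: "0 < \<epsilon>" and s: "semi_implicit_scheme E b chi T \<epsilon> dt x v e" and e0: "e 0 \<ge> 0"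
      and R: "norm (x 0) + norm (v 0) + \<bar>e 0\<bar> \<le> R" and n1: "1 \<le> n" and n: "n + 1 \<le> num_steps T dt"
    note bound = C1[OF \<epsilon> s e0 R]
    have small': "norm (perp (v (m + 1))) \<le> C2 * \<epsilon>" if m: "m + 1 \<le> num_steps T dt" for m
    proof -
      let ?t = "real m * dt"
      let ?H = "H_field E b chi ?t (x m) (perp (v m)) (e m)"
      have t: "?t \<in> {0..T}" using step_time[of dt m] dt m by simp
      have b: "b0 \<le> b (?t, perp (x m))" using b_lower[OF t] .
      have nn: "norm (x k) \<ge> 0" "norm (v k) \<ge> 0" "\<bar>e k\<bar> \<ge> 0" for k by auto
      have "norm (v m) \<le> \<bar>C1\<bar>" "norm (v (m + 1)) \<le> \<bar>C1\<bar>" "\<bar>e m\<bar> \<le> \<bar>C1\<bar>"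
        using bound[of m] bound[of "m + 1"] m nn[of m] nn[of "m + 1"] by linarith+
      then have "norm (v (m + 1) - v m) \<le> 2 * \<bar>C1\<bar>"
        using norm_triangle_ineq4[of "v (m + 1)" "v m"] by linarith
      then have 1: "norm ((1 / dt) *\<^sub>R (v (m + 1) - v m)) \<le> 2 * \<bar>C1\<bar> / dt"
        using dt by (simp add: divide_right_mono)
      have "K / b0 * \<bar>e m\<bar> \<le> K / b0 * \<bar>C1\<bar>"
        using \<open>\<bar>e m\<bar> \<le> \<bar>C1\<bar>\<close> K b0_pos by (intro mult_left_mono) auto
      then have 2: "norm ?H \<le> K + K / b0 * \<bar>C1\<bar>"
        using norm_H_field_le[OF t K(2,3)[OF t], of "x m" "v m" "e m"] by linarith
      have "norm (perp (v (m + 1))) = (\<epsilon> / b (?t, perp (x m))) * norm (rot (?H - (1 / dt) *\<^sub>R (v (m + 1) - v m)))"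
        using fast_velocity[OF s m dt(1) \<epsilon>] b b0_pos \<epsilon> by simp
      also have "\<dots> \<le> (\<epsilon> / b0) * (K + K / b0 * \<bar>C1\<bar> + 2 * \<bar>C1\<bar> / dt)"
      proof (intro mult_mono order_trans[OF norm_rot_le])
        show "norm (?H - (1 / dt) *\<^sub>R (v (m + 1) - v m)) \<le> K + K / b0 * \<bar>C1\<bar> + 2 * \<bar>C1\<bar> / dt"
          using norm_triangle_ineq4[of ?H "(1 / dt) *\<^sub>R (v (m + 1) - v m)"] 1 2 by linarith
      qed (use b b0_pos \<epsilon> in \<open>auto intro: frac_le\<close>)
      finally show ?thesis by (simp add: C2_def mult_ac)
    qed
    have small: "norm (perp (v m)) \<le> C2 * \<epsilon>" if "1 \<le> m" "m \<le> num_steps T dt" for m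
      using small'[of "m - 1"] that by simp
    have e_low: "- (real m * dt * (K * (C2 * \<epsilon>))) \<le> e m" if "m \<le> num_steps T dt" for m
      using that
    proof (induction m)
      case 0
      then show ?case using e0 by simp
    next
      case (Suc m)
      let ?t = "real m * dt"
      have m: "m + 1 \<le> num_steps T dt" using Suc.prems by simp
      have t: "?t \<in> {0..T}" using step_time[of dt m] dt m by simp
      have "\<bar>perp (E (?t, x m)) \<bullet> perp (v (m + 1))\<bar> \<le> K * (C2 * \<epsilon>)"
        using small'[OF m] K(1)
        by (intro order_trans[OF Cauchy_Schwarz_ineq2 mult_mono] order_trans[OF norm_perp_le K(2)[OF t]]) auto
      then have "- (K * (C2 * \<epsilon>)) \<le> perp (E (?t, x m)) \<bullet> perp (v (m + 1))" by linarith
      then have "dt * - (K * (C2 * \<epsilon>)) \<le> dt * (perp (E (?t, x m)) \<bullet> perp (v (m + 1)))"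
        using dt by (intro mult_left_mono) auto
      then show ?case
        using Suc schemeD(2)[OF s m dt(1)] by (simp add: algebra_simps)
    qed
    let ?t = "real n * dt"
    let ?\<beta> = "b (?t, perp (x n))"
    have n': "n \<le> num_steps T dt" using n by simp
    have t: "?t \<in> {0..T}" using step_time[of dt n] dt n by simp
    have b: "b0 \<le> ?\<beta>" using b_lower[OF t] .
    define r where "r = v (n + 1) - U_gc \<epsilon> E b ?t (x n) (e n) (v (n + 1) $ 3)"
    have chi_e: "\<bar>e n - chi (e n, perp (v n))\<bar> \<le> (2 * T * K * C2 + L * C2) * \<epsilon>"
    proof -
      (* For negative e the value chi (e, 0) is only known to lie between 0 and |e|; the lower
         bound on e makes |e| small in that case. *)
      have 1: "\<bar>e n - chi (e n, 0)\<bar> \<le> 2 * (T * (K * (C2 * \<epsilon>)))"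
      proof (cases "e n \<ge> 0")
        case True
        then show ?thesis using chi_zero T_pos K C2 \<epsilon> by simp
      next
        case False
        have "?t * (K * (C2 * \<epsilon>)) \<le> T * (K * (C2 * \<epsilon>))"
          using t K C2 \<epsilon> by (intro mult_right_mono) auto
        then have "\<bar>e n\<bar> \<le> T * (K * (C2 * \<epsilon>))" using False e_low[OF n'] by simp
        then show ?thesis using chi_bounds[of "e n" 0] unfolding perp_0 by linarith
      qed
      have nn: "norm (x n) \<ge> 0" "norm (v n) \<ge> 0" "\<bar>e n\<bar> \<ge> 0" "norm (perp (v n)) \<le> norm (v n)"
        by (auto simp: norm_perp_le)
      have "norm (e n, perp (v n)) \<le> \<bar>e n\<bar> + norm (perp (v n))"
        using norm_Pair_le[of "e n" "perp (v n)"] by simp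
      then have "norm (e n, perp (v n)) \<le> C1" "norm (e n, 0 :: real^3) \<le> C1"
        using bound[OF n'] nn norm_Pair_le[of "e n" "0 :: real^3"] unfolding norm_zero real_norm_def by linarith+
      then have mem: "(e n, perp (v n)) \<in> cball 0 C1" "(e n, 0 :: real^3) \<in> cball 0 C1"
        by (simp_all only: mem_cball_0)
      have "dist (chi (e n, 0)) (chi (e n, perp (v n))) \<le> L * dist (e n, 0 :: real^3) (e n, perp (v n))"
        by (rule lipschitz_onD[OF L mem(2,1)])
      also have "dist (e n, 0 :: real^3) (e n, perp (v n)) = norm (perp (v n))"
        by (simp add: dist_Pair_Pair)
      also have "L * norm (perp (v n)) \<le> L * (C2 * \<epsilon>)"
        using small[OF n1 n'] L0 by (intro mult_left_mono)
      finally show ?thesis using 1 by (simp add: dist_real_def algebra_simps)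
    qed
    have r: "norm r \<le> C3 * \<epsilon>\<^sup>2"
    proof -
      let ?w = "((e n - chi (e n, perp (v n))) / ?\<beta>) *\<^sub>R grad_b ?t (x n)
           - (1 / dt) *\<^sub>R (perp (v (n + 1)) - perp (v n))"
      have "norm r = (\<epsilon> / ?\<beta>) * norm (rot ?w)"
        unfolding r_def velocity_defect[OF s n dt(1) \<epsilon>] using b b0_pos \<epsilon> by simp
      also have "\<dots> \<le> (\<epsilon> / b0) * ((2 * T * K * C2 + L * C2) * \<epsilon> / b0 * K + 2 * (C2 * \<epsilon>) / dt)"
      proof (intro mult_mono order_trans[OF norm_rot_le] order_trans[OF norm_triangle_ineq4] add_mono)
        show "norm (((e n - chi (e n, perp (v n))) / ?\<beta>) *\<^sub>R grad_b ?t (x n)) \<le> (2 * T * K * C2 + L * C2) * \<epsilon> / b0 * K"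
          unfolding norm_scaleR abs_divide
          using chi_e b b0_pos K(3)[OF t] order_trans[OF abs_ge_zero chi_e] by (intro mult_mono frac_le) auto
        have "norm (perp (v (n + 1)) - perp (v n)) \<le> 2 * (C2 * \<epsilon>)"
          using small'[OF n] small[OF n1 n'] norm_triangle_ineq4[of "perp (v (n + 1))" "perp (v n)"] by linarith
        then show "norm ((1 / dt) *\<^sub>R (perp (v (n + 1)) - perp (v n))) \<le> 2 * (C2 * \<epsilon>) / dt"
          using dt by (simp add: divide_right_mono)
      qed (use b b0_pos \<epsilon> in \<open>auto intro: frac_le\<close>)
      also have "\<dots> = C3 * \<epsilon>\<^sup>2"
        using b0_pos dt by (simp add: C3_def power2_eq_square field_simps)
      finally show ?thesis .
    qed
    have "gc_residual \<epsilon> E b divF dt ?t (x n, e n, v n $ 3) (x (n + 1), e (n + 1), v (n + 1) $ 3)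
        = (r, perp (E (?t, x n)) \<bullet> r, 0)"
      using schemeD(1)[OF s n dt(1)] energy_defect[OF s n dt(1) \<epsilon>] parallel_defect[OF s n dt(1)] dt
      by (simp add: gc_residual_def r_def)
    moreover have "norm (r, perp (E (?t, x n)) \<bullet> r, 0 :: real) \<le> norm r + \<bar>perp (E (?t, x n)) \<bullet> r\<bar>"
      using norm_Pair_le[of r "(perp (E (?t, x n)) \<bullet> r, 0 :: real)"] by (simp add: norm_Pair)
    moreover have "\<bar>perp (E (?t, x n)) \<bullet> r\<bar> \<le> K * (C3 * \<epsilon>\<^sup>2)"
      using r K(1)
      by (intro order_trans[OF Cauchy_Schwarz_ineq2 mult_mono] order_trans[OF norm_perp_le K(2)[OF t]]) auto
    ultimately show "norm (gc_residual \<epsilon> E b divF dt ?t (x n, e n, v n $ 3) (x (n + 1), e (n + 1), v (n + 1) $ 3))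
        \<le> (C3 + K * C3) * \<epsilon>\<^sup>2"
      using r by (simp add: algebra_simps)
  qed
qed


section \<open>Accuracy in time of the guiding centre scheme\<close>

lemma inverse_b_regular: "lipschitz_bounded ({0..T} \<times> UNIV) (\<lambda>z. 1 / b (fst z, perp (snd z)))"
  by (rule lipschitz_bounded_inverse[OF b0_pos _ b_lipschitz]) (auto intro: b_lower)

lemma divF_regular: "lipschitz_bounded ({0..T} \<times> UNIV) divF"
proof -
  have eq: "divF z = (E z $ 2 * grad_b (fst z) (snd z) $ 1 - E z $ 1 * grad_b (fst z) (snd z) $ 2)
      * ((1 / b (fst z, perp (snd z))) * (1 / b (fst z, perp (snd z))))" if "z \<in> {0..T} \<times> UNIV" for z
    using divF_eq[of "fst z" "snd z"] b_lower[of "fst z" "snd z"] b0_pos that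
    by (auto simp: power2_eq_square field_simps)
  have "lipschitz_bounded ({0..T} \<times> UNIV) (\<lambda>z. (E z $ 2 * grad_b (fst z) (snd z) $ 1 - E z $ 1 * grad_b (fst z) (snd z) $ 2)
      * ((1 / b (fst z, perp (snd z))) * (1 / b (fst z, perp (snd z)))))"
    by (intro lipschitz_bounded_mult lipschitz_bounded_diff lipschitz_bounded_nth
        E_regular grad_b_regular inverse_b_regular)
  then show ?thesis
    unfolding lipschitz_bounded_def using eq by (simp cong: lipschitz_on_cong)
qed

text \<open>The restriction to bounded \<open>e\<close> and parallel velocity is needed for the products with the
  fields; the fields are globally Lipschitz in position, so the position is unrestricted.\<close>

lemma gc_vector_field_regular:
  "lipschitz_bounded ({0..T} \<times> UNIV \<times> cball 0 R \<times> cball 0 R)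
     (\<lambda>z. gc_vector_field \<epsilon> E b divF (fst z) (snd z))"
proof -
  let ?A = "{0..T} \<times> (UNIV :: (real^3) set) \<times> cball (0::real) R \<times> cball (0::real) R"
  let ?tx = "\<lambda>z :: real \<times> (real^3) \<times> real \<times> real. (fst z, fst (snd z))"
  have tx: "1-lipschitz_on ?A ?tx"
  proof (rule lipschitz_onI)
    fix z w :: "real \<times> (real^3) \<times> real \<times> real"
    obtain t x q where z: "z = (t, x, q)" by (cases z)
    obtain t' x' q' where w: "w = (t', x', q')" by (cases w)
    show "dist (?tx z) (?tx w) \<le> 1 * dist z w"
      by (simp add: z w dist_Pair_Pair)
  qed simp
  have lift: "lipschitz_bounded ?A (\<lambda>z. f (?tx z))" if "lipschitz_bounded ({0..T} \<times> UNIV) f"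
    for f :: "real \<times> (real^3) \<Rightarrow> 'b::real_normed_vector"
    by (rule lipschitz_bounded_compose[OF that tx]) auto
  have coord: "lipschitz_bounded ?A (\<lambda>z. fst (snd (snd z)))" "lipschitz_bounded ?A (\<lambda>z. snd (snd (snd z)))"
  proof -
    have coordinate: "lipschitz_bounded ?A p" if p: "\<And>z w. dist (p z) (p w) \<le> dist z w" "\<And>z. z \<in> ?A \<Longrightarrow> \<bar>p z\<bar> \<le> R"
      for p :: "real \<times> (real^3) \<times> real \<times> real \<Rightarrow> real"
    proof -
      have "1-lipschitz_on ?A p" using p(1) by (auto intro!: lipschitz_onI)
      then show ?thesis unfolding lipschitz_bounded_def real_norm_def using p(2) by blast
    qed
    show "lipschitz_bounded ?A (\<lambda>z. fst (snd (snd z)))"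
      by (rule coordinate) (auto intro: order_trans[OF dist_fst_le order_trans[OF dist_snd_le dist_snd_le]])
    show "lipschitz_bounded ?A (\<lambda>z. snd (snd (snd z)))"
      by (rule coordinate) (auto intro: order_trans[OF dist_snd_le order_trans[OF dist_snd_le dist_snd_le]])
  qed
  note b' = lift[OF inverse_b_regular] and E' = lift[OF E_regular] and g' = lift[OF grad_b_regular]
    and D' = lift[OF divF_regular]
  let ?b = "\<lambda>z :: real \<times> (real^3) \<times> real \<times> real. 1 / b (fst z, perp (fst (snd z)))"
  let ?f = "\<lambda>z. (snd (snd (snd z)) *\<^sub>R e_z - (\<epsilon> * ?b z) *\<^sub>R rot (E (?tx z)
        - (fst (snd (snd z)) * ?b z) *\<^sub>R grad_b (fst z) (fst (snd z))),
      \<epsilon> * divF (?tx z) * fst (snd (snd z)), E (?tx z) $ 3)"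
  have "lipschitz_bounded ?A ?f"
    using b' E' g' D'
    by (intro lipschitz_bounded_Pair lipschitz_bounded_diff lipschitz_bounded_scaleR lipschitz_bounded_mult
        lipschitz_bounded_const lipschitz_bounded_linear[OF bounded_linear_rot] lipschitz_bounded_nth coord)
       simp_all
  moreover have "gc_vector_field \<epsilon> E b divF (fst z) (snd z) = ?f z" if "z \<in> ?A" for z
    using that by (auto simp: gc_vector_field_def U_gc_alt)
  ultimately show ?thesis
    unfolding lipschitz_bounded_def by (simp cong: lipschitz_on_cong)
qed

text \<open>The energy solves a linear equation with bounded coefficient and the parallel velocity has a
  bounded derivative, so both stay in a bounded set that depends on the initial ball and
  on \<open>T\<close>, but not on the solution.\<close>

lemma drift_kinetic_bound:
  assumes "\<epsilon> > 0"
  shows "\<exists>R'. \<forall>h t y s. 0 \<le> t \<and> t + h \<le> T \<and> norm (y t) \<le> R \<and>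
      (\<forall>s\<in>{t..t + h}. (y has_vector_derivative gc_vector_field \<epsilon> E b divF s (y s)) (at s within {t..t + h})) \<and>
      s \<in> {t..t + h} \<longrightarrow> \<bar>fst (snd (y s))\<bar> \<le> R' \<and> \<bar>snd (snd (y s))\<bar> \<le> R'"
proof -
  obtain K where K: "K > 0" "\<And>t x. t \<in> {0..T} \<Longrightarrow> norm (E (t, x)) \<le> K"
    "\<And>t x. t \<in> {0..T} \<Longrightarrow> norm (grad_b t x) \<le> K"
    using field_bound by blast
  obtain M where M: "\<And>t x. t \<in> {0..T} \<Longrightarrow> \<bar>divF (t, x)\<bar> \<le> M"
    using divF_regular unfolding lipschitz_bounded_def real_norm_def by blast
  show ?thesis
  proof (intro exI[of _ "R + K * T + R * exp (\<epsilon> * M * T)"] allI impI; elim conjE)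
    fix h t s and y :: "real \<Rightarrow> (real^3) \<times> real \<times> real"
    assume t: "0 \<le> t" "t + h \<le> T" and R: "norm (y t) \<le> R" and s: "s \<in> {t..t + h}"
      and y: "\<forall>s\<in>{t..t + h}. (y has_vector_derivative gc_vector_field \<epsilon> E b divF s (y s)) (at s within {t..t + h})"
    define X e p where "X s = fst (y s)" and "e s = fst (snd (y s))" and "p s = snd (snd (y s))" for s
    have y_eq: "y s = (X s, e s, p s)" for s by (simp add: X_def e_def p_def)
    have in_T: "r \<in> {0..T}" if "r \<in> {t..t + h}" for r using that t by auto
    have R0: "0 \<le> R" "\<bar>e t\<bar> \<le> R" "\<bar>p t\<bar> \<le> R"
      using R norm_ge_zero[of "y t"] norm_fst_le[of "e t" "p t"] norm_snd_le[of "p t" "e t"]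
        norm_snd_le[of "(e t, p t)" "X t"] unfolding y_eq real_norm_def by linarith+
    have De: "(e has_vector_derivative (\<epsilon> * divF (r, X r)) * e r) (at r within {t..t + h})"
      and Dp: "(p has_vector_derivative E (r, X r) $ 3) (at r within {t..t + h})" if "r \<in> {t..t + h}" for r
    proof -
      have snd_y: "((\<lambda>s. snd (y s)) has_vector_derivative snd (gc_vector_field \<epsilon> E b divF r (y r))) (at r within {t..t + h})"
        using y that by (intro bounded_linear.has_vector_derivative[OF bounded_linear_snd]) auto
      show "(e has_vector_derivative (\<epsilon> * divF (r, X r)) * e r) (at r within {t..t + h})"
        using bounded_linear.has_vector_derivative[OF bounded_linear_fst snd_y]
        by (simp add: e_def[abs_def] X_def gc_vector_field_def case_prod_unfold)
      show "(p has_vector_derivative E (r, X r) $ 3) (at r within {t..t + h})"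
        using bounded_linear.has_vector_derivative[OF bounded_linear_snd snd_y]
        by (simp add: p_def[abs_def] X_def gc_vector_field_def case_prod_unfold)
    qed
    have sT: "s - t \<le> T" "0 \<le> s - t" using s t by auto
    have M0: "0 \<le> M" using M[of 0 0] T_pos by auto
    have "\<bar>e s\<bar> \<le> \<bar>e t\<bar> * exp (\<epsilon> * M * (s - t))"
      using De M in_T s assms
      by (intro linear_ode_bound[where b = "t + h" and k = "\<lambda>r. \<epsilon> * divF (r, X r)"]) (auto simp: abs_mult mult_left_mono)
    also have "\<dots> \<le> R * exp (\<epsilon> * M * T)"
      using R0 sT M0 assms by (intro mult_mono) (auto intro!: mult_left_mono)
    finally have e: "\<bar>e s\<bar> \<le> R * exp (\<epsilon> * M * T)" .
    have "norm (p s - p t) \<le> K * (s - t)"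
    proof (rule increment_bound[where b = "t + h"])
      show "norm (E (r, X r) $ 3) \<le> K" if "r \<in> {t..t + h}" for r
        using component_le_norm_cart[of "E (r, X r)" 3] K(2)[OF in_T[OF that], of "X r"] by simp
    qed (use Dp s in auto)
    also have "\<dots> \<le> K * T" using sT K by (intro mult_left_mono) auto
    finally have p: "\<bar>p s\<bar> \<le> R + K * T" using R0 by simp
    have "0 \<le> R * exp (\<epsilon> * M * T)" "0 \<le> K * T" using R0 K T_pos by auto
    then show "\<bar>fst (snd (y s))\<bar> \<le> R + K * T + R * exp (\<epsilon> * M * T) \<and> \<bar>snd (snd (y s))\<bar> \<le> R + K * T + R * exp (\<epsilon> * M * T)"
      using e p R0 by (simp add: e_def[symmetric] p_def[symmetric])
  qed
qed

text \<open>The scheme is the explicit Euler method except that the position is advanced with the new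
  parallel velocity. This changes the position by \<open>h\<^sup>2\<close> times the parallel electric field.\<close>

lemma gc_step_eq:
  assumes "gc_step \<epsilon> E b divF h t y y1" "h > 0"
  shows "y1 = y + h *\<^sub>R gc_vector_field \<epsilon> E b divF t y + ((h * (h * E (t, fst y) $ 3)) *\<^sub>R e_z, 0, 0)"
proof -
  obtain x e p where y: "y = (x, e, p)" by (cases y)
  obtain x1 e1 p1 where y1: "y1 = (x1, e1, p1)" by (cases y1)
  have step: "(1 / h) *\<^sub>R (x1 - x) = U_gc \<epsilon> E b t x e p1" "(e1 - e) / h = \<epsilon> * e * divF (t, x)"
    "(p1 - p) / h = E (t, x) $ 3"
    using assms(1) by (simp_all add: gc_step_def gc_residual_def y y1 prod_eq_iff)
  have p1: "p1 = p + h * E (t, x) $ 3" and "e1 = e + h * (\<epsilon> * e * divF (t, x))"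
    using step(2,3) assms(2) by (simp_all add: field_simps)
  moreover have "x1 = x + h *\<^sub>R U_gc \<epsilon> E b t x e p1"
    unfolding step(1)[symmetric] using assms(2) by simp
  ultimately show ?thesis
    by (simp add: y y1 gc_vector_field_def U_gc_def algebra_simps)
qed

text \<open>Along a solution the right-hand side is Lipschitz in time, so it differs from its initial
  value by \<open>O(h)\<close> during a step and the Euler step has error \<open>O(h\<^sup>2)\<close>.\<close>

lemma first_order_in_time:
  assumes "\<epsilon> > 0"
  shows "approximation_of_order 1 T (gc_vector_field \<epsilon> E b divF) (gc_step \<epsilon> E b divF)"
  unfolding approximation_of_order_def
proof
  fix R
  let ?f = "gc_vector_field \<epsilon> E b divF"
  obtain K where K: "K > 0" "\<And>t x. t \<in> {0..T} \<Longrightarrow> norm (E (t, x)) \<le> K"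
    "\<And>t x. t \<in> {0..T} \<Longrightarrow> norm (grad_b t x) \<le> K"
    using field_bound by blast
  obtain R' where R': "\<And>h t y s. 0 \<le> t \<Longrightarrow> t + h \<le> T \<Longrightarrow> norm (y t) \<le> R \<Longrightarrow>
      (\<And>s. s\<in>{t..t + h} \<Longrightarrow> (y has_vector_derivative ?f s (y s)) (at s within {t..t + h})) \<Longrightarrow>
      s \<in> {t..t + h} \<Longrightarrow> \<bar>fst (snd (y s))\<bar> \<le> R' \<and> \<bar>snd (snd (y s))\<bar> \<le> R'"
    using drift_kinetic_bound[OF assms, of R] by blast
  let ?A = "{0..T} \<times> (UNIV :: (real^3) set) \<times> cball 0 R' \<times> cball 0 R'"
  obtain L M where L: "L-lipschitz_on ?A (\<lambda>z. ?f (fst z) (snd z))"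
    and M: "\<And>z. z \<in> ?A \<Longrightarrow> norm (?f (fst z) (snd z)) \<le> M"
    using gc_vector_field_regular[of R' \<epsilon>] unfolding lipschitz_bounded_def by blast
  show "\<exists>C. \<forall>h t y y1. 0 < h \<and> 0 \<le> t \<and> t + h \<le> T \<and> norm (y t) \<le> R \<and>
        (\<forall>s\<in>{t..t + h}. (y has_vector_derivative ?f s (y s)) (at s within {t..t + h})) \<and>
        gc_step \<epsilon> E b divF h t (y t) y1 \<longrightarrow> norm (y (t + h) - y1) \<le> C * h ^ (1 + 1)"
  proof (intro exI[of _ "L * (1 + M) + K"] allI impI; elim conjE)
    fix h t and y :: "real \<Rightarrow> (real^3) \<times> real \<times> real" and y1
    assume h: "0 < h" and t: "0 \<le> t" "t + h \<le> T" and R: "norm (y t) \<le> R"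
      and y: "\<forall>s\<in>{t..t + h}. (y has_vector_derivative ?f s (y s)) (at s within {t..t + h})"
      and step: "gc_step \<epsilon> E b divF h t (y t) y1"
    have A: "(s, y s) \<in> ?A" if "s \<in> {t..t + h}" for s
      using R'[OF t, of y s] R y that t by (cases "y s") auto
    have tI: "t \<in> {t..t + h}" "t + h \<in> {t..t + h}" using h by auto
    have fM: "norm (?f s (y s)) \<le> M" if "s \<in> {t..t + h}" for s
      using M[OF A[OF that]] by simp
    have lip: "norm (?f s (y s) - ?f t (y t)) \<le> (L * (1 + M)) * h" if s: "s \<in> {t..t + h}" for s
    proof -
      have M0: "0 \<le> M" using order_trans[OF norm_ge_zero fM[OF s]] .
      have "norm (y s - y t) \<le> M * (s - t)"
        using y fM s by (intro increment_bound[where b = "t + h"]) auto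
      also have "\<dots> \<le> M * h" using s M0 by (intro mult_left_mono) auto
      finally have "dist (s, y s) (t, y t) \<le> h + M * h"
        using s norm_Pair_le[of "s - t" "y s - y t"] by (simp add: dist_norm)
      then have "L * dist (s, y s) (t, y t) \<le> L * (h + M * h)"
        by (intro mult_left_mono lipschitz_on_nonneg[OF L])
      then show ?thesis
        using lipschitz_onD[OF L A[OF s] A[OF tI(1)]] by (simp add: dist_norm algebra_simps)
    qed
    have "norm (y (t + h) - y t - (t + h - t) *\<^sub>R ?f t (y t)) \<le> norm (t + h - t) * ((L * (1 + M)) * h)"
      using y lip tI by (intro vector_differentiable_bound_linearization[where S = "{t..t + h}"])
        (auto simp: closed_segment_eq_real_ivl)
    then have 1: "norm (y (t + h) - y t - h *\<^sub>R ?f t (y t)) \<le> h * ((L * (1 + M)) * h)"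
      using h by simp
    have e_z: "norm e_z = 1" by (simp add: norm_eq_1 inner_vec3)
    have "\<bar>E (t, fst (y t)) $ 3\<bar> \<le> K"
      using component_le_norm_cart[of "E (t, fst (y t))" 3] K(2)[of t "fst (y t)"] t h by simp
    then have 2: "norm ((h * (h * E (t, fst (y t)) $ 3)) *\<^sub>R e_z, 0 :: real, 0 :: real) \<le> h * (h * K)"
      using h by (simp add: norm_Pair abs_mult e_z zero_prod_def[symmetric])
    have split: "y (t + h) - y1 = (y (t + h) - y t - h *\<^sub>R ?f t (y t)) - ((h * (h * E (t, fst (y t)) $ 3)) *\<^sub>R e_z, 0, 0)"
      unfolding gc_step_eq[OF step h] by (simp add: algebra_simps)
    have "norm (y (t + h) - y1) \<le> h * ((L * (1 + M)) * h) + h * (h * K)"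
      unfolding split by (rule order_trans[OF norm_triangle_ineq4 add_mono[OF 1 2]])
    then show "norm (y (t + h) - y1) \<le> (L * (1 + M) + K) * h ^ (1 + 1)"
      by (simp add: algebra_simps power2_eq_square)
  qed
qed

end

section \<open>Uniform bounds and consistency of the schemes\<close>

theorem proposition3p1:
  fixes T b0 :: real
    and \<phi> b chi divF :: "real \<times> (real^3) \<Rightarrow> real"
    and E :: "real \<times> (real^3) \<Rightarrow> real^3"
  assumes "T > 0"
    and E_grad: "\<And>i. weak_deriv ({0<..<T} \<times> UNIV) (0, axis i 1) \<phi> (\<lambda>z. - (E z $ i))"
    and E_W: "\<And>i. W_infty 1 ({0<..<T} \<times> UNIV) (\<lambda>z. E z $ i)"
    and E_cont: "continuous_on ({0..T} \<times> UNIV) E"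
    and b0: "b0 > 0" "\<And>t x. t \<in> {0<..<T} \<Longrightarrow> b (t, perp x) > b0"
    and b_W: "W_infty 2 ({0<..<T} \<times> UNIV) (\<lambda>(t, x). b (t, perp x))"
    and b_cont: "continuous_on ({0..T} \<times> UNIV) (\<lambda>(t, x). b (t, perp x))"
    and chi_W: "W_infty_loc 1 UNIV chi"
    and chi_cont: "continuous_on UNIV chi"
    and chi_kinetic: "\<And>v. chi ((norm (perp v))\<^sup>2 / 2, perp v) = 0"
    and chi_zero: "\<And>e. e \<ge> 0 \<Longrightarrow> chi (e, 0) = e"
    and chi_bounds: "\<And>e v. 0 \<le> chi (e, perp v) \<and> chi (e, perp v) \<le> \<bar>e\<bar>"
    and divF: "weak_div_perp ({0<..<T} \<times> UNIV) (\<lambda>(t, x). rot (perp (F_field E b t x))) divF"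
    and divF_cont: "continuous_on ({0..T} \<times> UNIV) divF"
  shows "(\<forall>R. \<exists>C. \<forall>dt \<epsilon> x v e.
            0 < dt \<and> dt \<le> T \<and> 0 < \<epsilon> \<and> semi_implicit_scheme E b chi T \<epsilon> dt x v e \<and>
            e 0 \<ge> 0 \<and> norm (x 0) + norm (v 0) + \<bar>e 0\<bar> \<le> R
            \<longrightarrow> (\<forall>n\<le>num_steps T dt. norm (x n) + norm (v n) + \<bar>e n\<bar> \<le> C))
       \<and> (\<forall>R dt. 0 < dt \<and> dt \<le> T \<longrightarrow> (\<exists>C. \<forall>\<epsilon> x v e.
            0 < \<epsilon> \<and> semi_implicit_scheme E b chi T \<epsilon> dt x v e \<and>
            e 0 \<ge> 0 \<and> norm (x 0) + norm (v 0) + \<bar>e 0\<bar> \<le> R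
            \<longrightarrow> (\<forall>n\<ge>1. n + 1 \<le> num_steps T dt \<longrightarrow>
                  norm (gc_residual \<epsilon> E b divF dt (real n * dt)
                         (x n, e n, v n $ 3) (x (n + 1), e (n + 1), v (n + 1) $ 3))
                    \<le> C * \<epsilon>\<^sup>2)))
       \<and> (\<forall>\<epsilon>>0. approximation_of_order 1 T
            (gc_vector_field \<epsilon> E b divF) (gc_step \<epsilon> E b divF))"
proof -
  interpret regular_fields T b0 E b divF chi
    by (rule regular_fieldsI) (use assms in auto)
  show ?thesis
    using uniform_bound second_order_consistent first_order_in_time by blast
qed

end
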